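(* For every $a>0$, $c>0$, $\mu\ge 0$, $b>0$, $k>0$, $\lambda>0$ there exist constants $\omega, G, \gamma_1, \gamma_2>0$ such that the following holds. Let $f\in C^0(\mathbb{R}_+;L^2(0,1))\cap C^0((0,+\infty)\times(0,1))$ and $d\in C^0(\mathbb{R}_+)$ be arbitrary inputs, and let $u\in C^1(\mathbb{R}_+\times[0,1])\cap C^2((0,+\infty)\times(0,1))$ and $\theta\in C^0(\mathbb{R}_+\times[0,1])\cap C^1((0,+\infty);L^2(0,1))$ with $\theta[t]\in H^2(0,1)$ for all $t>0$ be any solution of $$u_{tt}(t,x)=c^2u_{xx}(t,x)-\mu u_t(t,x)-b\,\theta_x(t,x)+f(t,x),\quad t>0,\ x\in(0,1),$$ $$\theta_t(t,x)=k\,\theta_{xx}(t,x)-\lambda u_{xt}(t,x),\quad t>0,\ x\in(0,1),$$ $$u(t,0)=0,\quad t>0,$$ $$u_x(t,1)=-a\,u_t(t,1)+d(t),\quad t>0,$$ $$\theta(t,0)=\theta(t,1)=0,\quad t>0.$$ Then for all $t\ge 0$, $$\left(\|u_t[t]\|_2^2+\|u_x[t]\|_2^2+\|\theta[t]\|_2^2\right)^{1/2}\le G\exp(-\omega t)\left(\|u_t[0]\|_2^2+\|u_x[0]\|_2^2+\|\theta[0]\|_2^2\right)^{1/2}+\gamma_1\sup_{0\le s\le t}\left(\|f[s]\|_2\right)+\gamma_2\sup_{0\le s\le t}\left(|d(s)|\right).$$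
   Context: $\mathbb{R}_+=[0,+\infty)$. All functions are real-valued. For an open set $S\subseteq\mathbb{R}^n$ and a set $A$ with $S\subseteq A\subseteq \mathrm{cl}(S)$, $C^0(A)$ is the class of continuous functions on $A$, and $C^k(A)$ ($k\ge1$) is the class of functions on $A$ that have continuous derivatives up to order $k$ in $S=\mathrm{int}(A)$ which can be continued continuously to all points of $\partial S\cap A$ (the values of derivatives at such points are these continuous extensions). For an interval $I$ and a normed space $Y$, $C^0(I;Y)$ (resp. $C^1(I;Y)$) is the class of continuous (resp. continuously differentiable) functions $I\to Y$. For a function $w$ of $(t,x)$, $w[t]$ denotes the profile $x\mapsto w(t,x)$, $x\in[0,1]$; subscripts $t,x$ denote partial derivatives. $H^2(0,1)$ is the Sobolev space of functions in $L^2(0,1)$ with all weak derivatives up to order $2$ in $L^2(0,1)$. $\|\cdot\|_2$ is the norm of $L^2(0,1)$: $\|v\|_2=\left(\int_0^1|v(x)|^2dx\right)^{1/2}$. For each $t>0$, $\theta_t[t]\in L^2(0,1)$ is the derivative of the $L^2(0,1)$-valued map $t\mapsto\theta[t]$, $\theta_x[t],\theta_{xx}[t]$ are the weak derivatives of $\theta[t]\in H^2(0,1)$, and the equation for $\theta_t$ is understood for almost every $x\in(0,1)$. The constants $\omega,G,\gamma_1,\gamma_2$ depend only on $a,c,\mu,b,k,\lambda$ and not on $u,\theta,f,d$. *)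

theory Defs
  imports "HOL-Analysis.Analysis"
begin

text \<open>
  A function \<open>w\<close> of \<open>(t, x)\<close> is a function on \<open>real \<times> real\<close>; its profile \<open>x \<mapsto> w (t, x)\<close>
  is \<open>curry w t\<close>. Values outside the domain of interest are irrelevant.
\<close>

text \<open>
  The function \<open>g\<close> on the interior of \<open>A\<close>, and its limit along the interior at the other
  points of \<open>A\<close>. If \<open>g\<close> has a continuous continuation to \<open>A\<close>, this is that continuation.
\<close>

definition extend_to :: "(real \<times> real) set \<Rightarrow> (real \<times> real \<Rightarrow> real) \<Rightarrow> real \<times> real \<Rightarrow> real" where
  "extend_to A g p = (if p \<in> interior A then g p else Lim (at p within interior A) g)"

definition pd_t :: "(real \<times> real) set \<Rightarrow> (real \<times> real \<Rightarrow> real) \<Rightarrow> real \<times> real \<Rightarrow> real" where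
  "pd_t A w = extend_to A (\<lambda>(t, x). deriv (\<lambda>s. w (s, x)) t)"

definition pd_x :: "(real \<times> real) set \<Rightarrow> (real \<times> real \<Rightarrow> real) \<Rightarrow> real \<times> real \<Rightarrow> real" where
  "pd_x A w = extend_to A (\<lambda>(t, x). deriv (\<lambda>y. w (t, y)) x)"

text \<open>
  \<open>C_class k A w\<close> is intended for \<open>interior A \<subseteq> A \<subseteq> closure (interior A)\<close>. Continuity on \<open>A\<close>
  of the extended partial derivatives says that the derivatives are continuous in the interior
  and can be continued continuously to the remaining points of \<open>A\<close>.
\<close>

fun C_class :: "nat \<Rightarrow> (real \<times> real) set \<Rightarrow> (real \<times> real \<Rightarrow> real) \<Rightarrow> bool" where
  "C_class 0 A w \<longleftrightarrow> continuous_on A w"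
| "C_class (Suc k) A w \<longleftrightarrow>
     continuous_on A w \<and>
     (\<forall>t x. (t, x) \<in> interior A \<longrightarrow>
        (\<lambda>s. w (s, x)) differentiable at t \<and> (\<lambda>y. w (t, y)) differentiable at x) \<and>
     C_class k A (pd_t A w) \<and> C_class k A (pd_x A w)"

text \<open>Elements of \<open>L\<^sup>2(0,1)\<close> are given by representatives; \<open>norm2\<close> is a seminorm on these.\<close>

definition L2 :: "(real \<Rightarrow> real) set" where
  "L2 = {v. v \<in> borel_measurable (lebesgue_on {0<..<1}) \<and>
            integrable (lebesgue_on {0<..<1}) (\<lambda>x. (v x)\<^sup>2)}"

definition norm2 :: "(real \<Rightarrow> real) \<Rightarrow> real" where
  "norm2 v = sqrt (LINT x|lebesgue_on {0<..<1}. \<bar>v x\<bar>\<^sup>2)"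

definition C0_L2 :: "real set \<Rightarrow> (real \<Rightarrow> real \<Rightarrow> real) \<Rightarrow> bool" where
  "C0_L2 I v \<longleftrightarrow> (\<forall>t\<in>I. v t \<in> L2) \<and>
     (\<forall>t\<in>I. ((\<lambda>s. norm2 (\<lambda>x. v s x - v t x)) \<longlongrightarrow> 0) (at t within I))"

text \<open>\<open>v\<close> is of class \<open>C\<^sup>1(I; L\<^sup>2(0,1))\<close> and its derivative is (represented by) \<open>v'\<close>.\<close>

definition C1_L2 :: "real set \<Rightarrow> (real \<Rightarrow> real \<Rightarrow> real) \<Rightarrow> (real \<Rightarrow> real \<Rightarrow> real) \<Rightarrow> bool" where
  "C1_L2 I v v' \<longleftrightarrow> C0_L2 I v \<and> C0_L2 I v' \<and>
     (\<forall>t\<in>I. ((\<lambda>s. norm2 (\<lambda>x. (v s x - v t x) / (s - t) - v' t x)) \<longlongrightarrow> 0) (at t within I))"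

definition test_function :: "(real \<Rightarrow> real) \<Rightarrow> bool" where
  "test_function \<phi> \<longleftrightarrow> (\<forall>n. (deriv ^^ n) \<phi> differentiable_on UNIV) \<and>
     (\<exists>K. compact K \<and> K \<subseteq> {0<..<1} \<and> (\<forall>x. x \<notin> K \<longrightarrow> \<phi> x = 0))"

text \<open>For \<open>v\<close> and \<open>w\<close> in \<open>L2\<close> both integrands below are integrable.\<close>

definition weak_deriv :: "nat \<Rightarrow> (real \<Rightarrow> real) \<Rightarrow> (real \<Rightarrow> real) \<Rightarrow> bool" where
  "weak_deriv n v w \<longleftrightarrow> (\<forall>\<phi>. test_function \<phi> \<longrightarrow>
     (LINT x|lebesgue_on {0<..<1}. v x * (deriv ^^ n) \<phi> x) =
     (-1) ^ n * (LINT x|lebesgue_on {0<..<1}. w x * \<phi> x))"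

definition H_sob :: "nat \<Rightarrow> (real \<Rightarrow> real) set" where
  "H_sob m = {v \<in> L2. \<forall>n\<le>m. \<exists>w\<in>L2. weak_deriv n v w}"

abbreviation closed_strip :: "(real \<times> real) set" where
  "closed_strip \<equiv> {0..} \<times> {0..1}"

abbreviation open_strip :: "(real \<times> real) set" where
  "open_strip \<equiv> {0<..} \<times> {0<..<1}"

definition admissible_input :: "(real \<times> real \<Rightarrow> real) \<Rightarrow> (real \<Rightarrow> real) \<Rightarrow> bool" where
  "admissible_input f d \<longleftrightarrow>
     C0_L2 {0..} (curry f) \<and> C_class 0 open_strip f \<and> continuous_on {0..} d"

text \<open>
  The functions \<open>\<theta>t\<close>, \<open>\<theta>x\<close>, \<open>\<theta>xx\<close> represent elements of \<open>L\<^sup>2(0,1)\<close> at each \<open>t > 0\<close>. The first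
  equation holds at every \<open>x\<close>; since all its other terms are continuous in \<open>x\<close>, this
  forces \<open>\<theta>x\<close> to be the continuous representative of the weak derivative.
\<close>

definition is_solution ::
  "real \<Rightarrow> real \<Rightarrow> real \<Rightarrow> real \<Rightarrow> real \<Rightarrow> real \<Rightarrow> (real \<times> real \<Rightarrow> real) \<Rightarrow> (real \<Rightarrow> real) \<Rightarrow>
   (real \<times> real \<Rightarrow> real) \<Rightarrow> (real \<times> real \<Rightarrow> real) \<Rightarrow> bool" where
  "is_solution a c \<mu> b k lam f d u \<theta> \<longleftrightarrow>
     C_class 1 closed_strip u \<and> C_class 2 open_strip u \<and>
     C_class 0 closed_strip \<theta> \<and>
     (\<forall>t>0. curry \<theta> t \<in> H_sob 2) \<and>
     (\<exists>\<theta>t \<theta>x \<theta>xx.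
        C1_L2 {0<..} (curry \<theta>) (curry \<theta>t) \<and>
        (\<forall>t>0. curry \<theta>x t \<in> L2 \<and> weak_deriv 1 (curry \<theta> t) (curry \<theta>x t)) \<and>
        (\<forall>t>0. curry \<theta>xx t \<in> L2 \<and> weak_deriv 2 (curry \<theta> t) (curry \<theta>xx t)) \<and>
        (\<forall>t>0. \<forall>x\<in>{0<..<1}.
           pd_t open_strip (pd_t open_strip u) (t, x) =
             c\<^sup>2 * pd_x open_strip (pd_x open_strip u) (t, x)
             - \<mu> * pd_t open_strip u (t, x) - b * \<theta>x (t, x) + f (t, x)) \<and>
        (\<forall>t>0. AE x in lebesgue_on {0<..<1}.
           \<theta>t (t, x) = k * \<theta>xx (t, x) - lam * pd_t open_strip (pd_x open_strip u) (t, x))) \<and>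
     (\<forall>t>0. u (t, 0) = 0) \<and>
     (\<forall>t>0. pd_x closed_strip u (t, 1) = - a * pd_t closed_strip u (t, 1) + d t) \<and>
     (\<forall>t>0. \<theta> (t, 0) = 0 \<and> \<theta> (t, 1) = 0)"

definition state_norm :: "(real \<times> real \<Rightarrow> real) \<Rightarrow> (real \<times> real \<Rightarrow> real) \<Rightarrow> real \<Rightarrow> real" where
  "state_norm u \<theta> t =
     sqrt ((norm2 (curry (pd_t closed_strip u) t))\<^sup>2
         + (norm2 (curry (pd_x closed_strip u) t))\<^sup>2
         + (norm2 (curry \<theta> t))\<^sup>2)"

end

theory Submission
  imports Defs
begin

text \<open>
  The estimate comes from the Lyapunov functional
  \<open>V = \<integral> (u\<^sub>t\<^sup>2 / 2 + c\<^sup>2 u\<^sub>x\<^sup>2 / 2 + \<epsilon> x u\<^sub>x u\<^sub>t) dx + b / (2 \<lambda>) \<parallel>\<theta>\<parallel>\<^sup>2\<close> with a small weight \<open>\<epsilon>\<close>.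
  With the factor \<open>b / \<lambda>\<close> the coupling terms of the two equations cancel, so the energy part loses
  \<open>\<mu> \<parallel>u\<^sub>t\<parallel>\<^sup>2\<close>, \<open>(b k / \<lambda>) \<parallel>\<theta>\<^sub>x\<parallel>\<^sup>2\<close> and, through the boundary condition at \<open>x = 1\<close>, a multiple of
  \<open>u\<^sub>t(t,1)\<^sup>2\<close>. The multiplier term \<open>x u\<^sub>x u\<^sub>t\<close> produces \<open>- \<epsilon> / 2 (\<parallel>u\<^sub>t\<parallel>\<^sup>2 + c\<^sup>2 \<parallel>u\<^sub>x\<parallel>\<^sup>2)\<close>, and for small
  \<open>\<epsilon>\<close> everything else that it produces is absorbed by the losses above. Poincare's inequality turns
  \<open>\<parallel>\<theta>\<^sub>x\<parallel>\<close> into \<open>\<parallel>\<theta>\<parallel>\<close>. Hence \<open>V' \<le> - \<sigma> V + C (\<parallel>f\<parallel>\<^sup>2 + d\<^sup>2)\<close>, and since \<open>V\<close> is equivalent to the squared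
  norm of the state, solving this inequality and taking a square root gives the theorem. The
  pointwise estimates behind it are \<open>source_bound\<close>, \<open>flux_at_1\<close>, \<open>density_bounds\<close> and \<open>density_decay\<close>.

  The work lies in the low regularity. The function \<open>u\<close> is twice differentiable only in the open
  strip, without integrability of \<open>u\<^sub>t\<^sub>t\<close> and \<open>u\<^sub>x\<^sub>x\<close> up to the boundary. Therefore the
  mechanical part of \<open>V\<close> is first restricted to \<open>[\<delta>, 1 - \<delta>]\<close>, where differentiation under the integral
  and the fundamental theorem of calculus apply (\<open>mech_integral_deriv\<close>). The truncated functional
  satisfies the differential inequality up to errors that are uniform in time on \<open>[s, t]\<close>, \<open>s > 0\<close>:
  the flux through \<open>\<delta>\<close> and \<open>1 - \<delta>\<close> tends to the flux at the boundary since \<open>u\<^sub>t\<close> and \<open>u\<^sub>x\<close> are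
  continuous on the closed strip, and the coupling term left over near the boundary is absorbed by
  \<open>\<parallel>\<theta>\<^sub>x\<parallel>\<^sup>2\<close> (\<open>truncated_dissipation\<close>). The limits \<open>\<delta> \<rightarrow> 0\<close> and
  \<open>s \<rightarrow> 0\<close> only use the continuity of the state (\<open>lyap_decay_positive_time\<close>, \<open>lyap_decay\<close>).

  For the thermal part, the heat equation says that \<open>k \<theta>\<^sub>x - \<lambda> u\<^sub>t\<close> has the weak derivative \<open>\<theta>\<^sub>t\<close>, and
  \<open>\<integral> \<theta> \<theta>\<^sub>t dx = - \<integral> \<theta>\<^sub>x (k \<theta>\<^sub>x - \<lambda> u\<^sub>t) dx\<close> is needed although \<open>\<theta>\<close> is not a test function
  (\<open>weak_integration_by_parts\<close>). Testing with smooth plateaus shows that a continuous function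
  with an integrable weak derivative is an indefinite integral of it (\<open>weak_deriv_integral\<close>); the
  formula then follows from integration by parts for indefinite integrals on compact subintervals.
\<close>

section \<open>Square-integrable functions on the unit interval\<close>

abbreviation unit_lebesgue :: "real measure" where
  "unit_lebesgue \<equiv> lebesgue_on {0<..<1}"

lemma L2_measurable [measurable_dest]: "v \<in> L2 \<Longrightarrow> v \<in> borel_measurable unit_lebesgue"
  by (simp add: L2_def)

lemma L2_integrable_square: "v \<in> L2 \<Longrightarrow> integrable unit_lebesgue (\<lambda>x. (v x)\<^sup>2)"
  by (simp add: L2_def)

lemma integrable_unit_const [simp]: "integrable unit_lebesgue (\<lambda>x. (r::real))"
proof -
  have "finite_measure unit_lebesgue"
    by (rule finite_measureI) (simp add: emeasure_restrict_space)
  then show ?thesis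
    by (rule finite_measure.integrable_const)
qed

lemma integral_unit_const [simp]: "(LINT x|unit_lebesgue. (r::real)) = r"
  by (simp add: measure_restrict_space)

lemma L2_mult_integrable:
  assumes "v \<in> L2" "w \<in> L2"
  shows "integrable unit_lebesgue (\<lambda>x. v x * w x)"
proof (rule Bochner_Integration.integrable_bound)
  show "integrable unit_lebesgue (\<lambda>x. (v x)\<^sup>2 + (w x)\<^sup>2)"
    using assms by (intro Bochner_Integration.integrable_add L2_integrable_square)
  show "(\<lambda>x. v x * w x) \<in> borel_measurable unit_lebesgue"
    using assms by measurable
  have "\<bar>p * q\<bar> \<le> p\<^sup>2 + q\<^sup>2" for p q :: real
  proof -
    have "2 * (\<bar>p\<bar> * \<bar>q\<bar>) \<le> p\<^sup>2 + q\<^sup>2"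
      using sum_squares_bound[of "\<bar>p\<bar>" "\<bar>q\<bar>"] by (simp add: mult.assoc)
    moreover have "0 \<le> \<bar>p\<bar> * \<bar>q\<bar>" by simp
    ultimately show ?thesis unfolding abs_mult by linarith
  qed
  then show "AE x in unit_lebesgue. norm (v x * w x) \<le> norm ((v x)\<^sup>2 + (w x)\<^sup>2)"
    by (simp add: sum_power2_ge_zero)
qed

lemma L2_const: "(\<lambda>x. r) \<in> L2"
  by (simp add: L2_def)

lemma L2_integrable: "v \<in> L2 \<Longrightarrow> integrable unit_lebesgue v"
  using L2_mult_integrable[of v "\<lambda>x. 1"] L2_const by simp

lemma L2_scale: "v \<in> L2 \<Longrightarrow> (\<lambda>x. r * v x) \<in> L2"
  by (auto simp: L2_def power_mult_distrib)

lemma L2_add: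
  assumes "v \<in> L2" "w \<in> L2"
  shows "(\<lambda>x. v x + w x) \<in> L2"
proof -
  have "integrable unit_lebesgue (\<lambda>x. (v x)\<^sup>2 + (w x)\<^sup>2 + 2 * (v x * w x))"
    using assms by (intro Bochner_Integration.integrable_add integrable_mult_right L2_integrable_square
      L2_mult_integrable)
  then have "integrable unit_lebesgue (\<lambda>x. (v x + w x)\<^sup>2)"
    by (simp add: power2_eq_square algebra_simps)
  then show ?thesis
    using assms by (auto simp: L2_def)
qed

lemma L2_diff:
  assumes "v \<in> L2" "w \<in> L2"
  shows "(\<lambda>x. v x - w x) \<in> L2"
  using L2_add[OF assms(1) L2_scale[OF assms(2), of "-1"]] by simp

lemma norm2_sq: "(norm2 v)\<^sup>2 = (LINT x|unit_lebesgue. (v x)\<^sup>2)"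
  by (simp add: norm2_def)

lemma norm2_nonneg: "0 \<le> norm2 v"
  by (simp add: norm2_def)

lemma L2_Cauchy_Schwarz:
  assumes "v \<in> L2" "w \<in> L2"
  shows "\<bar>LINT x|unit_lebesgue. v x * w x\<bar> \<le> norm2 v * norm2 w"
proof -
  let ?A = "(norm2 v)\<^sup>2" and ?B = "LINT x|unit_lebesgue. v x * w x" and ?C = "(norm2 w)\<^sup>2"
  have pos: "0 \<le> ?A * r\<^sup>2 + 2 * ?B * r * s + ?C * s\<^sup>2" for r s :: real
  proof -
    have "0 \<le> (LINT x|unit_lebesgue. (r * v x + s * w x)\<^sup>2)"
      by simp
    also have "\<dots> = (LINT x|unit_lebesgue. r\<^sup>2 * (v x)\<^sup>2 + (2 * r * s) * (v x * w x) + s\<^sup>2 * (w x)\<^sup>2)"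
      by (simp add: power2_eq_square algebra_simps)
    also have "\<dots> = r\<^sup>2 * ?A + (2 * r * s) * ?B + s\<^sup>2 * ?C"
      unfolding norm2_sq using assms
      by (simp add: L2_integrable_square L2_mult_integrable)
    finally show ?thesis by (simp add: algebra_simps)
  qed
  \<comment> \<open>Nonnegativity of the form is used at \<open>(C, - B)\<close>, where it equals \<open>C (A C - B\<^sup>2)\<close>; if \<open>C = 0\<close>, it is
    affine in \<open>s\<close> and cannot be bounded below unless \<open>B = 0\<close>.\<close>
  have "?B\<^sup>2 \<le> ?A * ?C"
  proof (cases "?C = 0")
    case True
    have "?B = 0"
    proof (rule ccontr)
      assume "?B \<noteq> 0"
      then show False
        using pos[of 1 "- (?A + 1) / (2 * ?B)"] True by (simp add: field_simps)
    qed
    then show ?thesis using True by simp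
  next
    case False
    then have "0 < ?C" by simp
    have "0 \<le> ?C * (?A * ?C - ?B\<^sup>2)"
      using pos[of ?C "- ?B"] by (simp add: power2_eq_square algebra_simps)
    then have "0 \<le> ?A * ?C - ?B\<^sup>2"
      using \<open>0 < ?C\<close> by (simp add: zero_le_mult_iff)
    then show ?thesis by simp
  qed
  then have "?B\<^sup>2 \<le> (norm2 v * norm2 w)\<^sup>2"
    by (simp add: power_mult_distrib)
  then show ?thesis
    using norm2_nonneg by (metis abs_le_square_iff abs_of_nonneg mult_nonneg_nonneg)
qed

lemma norm2_triangle:
  assumes "v \<in> L2" "w \<in> L2"
  shows "norm2 (\<lambda>x. v x + w x) \<le> norm2 v + norm2 w"
proof -
  have "(norm2 (\<lambda>x. v x + w x))\<^sup>2 = (LINT x|unit_lebesgue. (v x)\<^sup>2 + 2 * (v x * w x) + (w x)\<^sup>2)"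
    unfolding norm2_sq by (simp add: power2_eq_square algebra_simps)
  also have "\<dots> = (norm2 v)\<^sup>2 + 2 * (LINT x|unit_lebesgue. v x * w x) + (norm2 w)\<^sup>2"
    unfolding norm2_sq using assms by (simp add: L2_integrable_square L2_mult_integrable)
  also have "\<dots> \<le> (norm2 v + norm2 w)\<^sup>2"
    using L2_Cauchy_Schwarz[OF assms] by (simp add: power2_sum)
  finally show ?thesis
    by (rule power2_le_imp_le) (simp add: norm2_nonneg)
qed

lemma norm2_minus: "norm2 (\<lambda>x. v x - w x) = norm2 (\<lambda>x. w x - v x)"
  by (simp add: norm2_def power2_commute)

lemma norm2_diff_bound:
  assumes "v \<in> L2" "w \<in> L2"
  shows "\<bar>norm2 v - norm2 w\<bar> \<le> norm2 (\<lambda>x. v x - w x)"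
  using norm2_triangle[OF L2_diff[OF assms] assms(2)]
    norm2_triangle[OF L2_diff[OF assms(2,1)] assms(1)] norm2_minus[of v w]
  by simp

lemma C0_L2_norm2_continuous:
  assumes "C0_L2 I v"
  shows "continuous_on I (\<lambda>t. norm2 (v t))"
  unfolding continuous_on_def
proof
  fix t assume t: "t \<in> I"
  have "((\<lambda>s. norm2 (v s) - norm2 (v t)) \<longlongrightarrow> 0) (at t within I)"
  proof (rule Lim_null_comparison)
    show "\<forall>\<^sub>F s in at t within I. norm (norm2 (v s) - norm2 (v t)) \<le> norm2 (\<lambda>x. v s x - v t x)"
      using assms t norm2_diff_bound by (auto simp: eventually_at_filter C0_L2_def)
    show "((\<lambda>s. norm2 (\<lambda>x. v s x - v t x)) \<longlongrightarrow> 0) (at t within I)"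
      using assms t by (simp add: C0_L2_def)
  qed
  then show "((\<lambda>s. norm2 (v s)) \<longlongrightarrow> norm2 (v t)) (at t within I)"
    by (rule LIM_zero_cancel)
qed

text \<open>
  The difference quotient of the squared norm is the pairing of the difference quotient \<open>q s\<close> of
  \<open>v\<close> with \<open>v s + v t = 2 * v t + (s - t) * q s\<close>, and \<open>q s\<close> converges in norm.
\<close>

lemma C1_L2_norm2_sq_deriv:
  assumes C1: "C1_L2 I v v'" and t: "t \<in> I"
  shows "((\<lambda>s. (norm2 (v s))\<^sup>2) has_real_derivative 2 * (LINT x|unit_lebesgue. v t x * v' t x))
    (at t within I)"
proof -
  define q where "q s x = (v s x - v t x) / (s - t)" for s x
  define e where "e s = norm2 (\<lambda>x. q s x - v' t x)" for s
  have L2: "v s \<in> L2" "v' s \<in> L2" if "s \<in> I" for s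
    using C1 that by (auto simp: C1_L2_def C0_L2_def)
  have qL2: "q s \<in> L2" if "s \<in> I" for s
    using L2_scale[OF L2_diff[OF L2(1)[OF that] L2(1)[OF t]], of "1 / (s - t)"]
    unfolding q_def by simp
  have e0: "(e \<longlongrightarrow> 0) (at t within I)"
    using C1 t unfolding e_def q_def C1_L2_def by blast
  have bound: "\<bar>((norm2 (v s))\<^sup>2 - (norm2 (v t))\<^sup>2) / (s - t) - 2 * (LINT x|unit_lebesgue. v t x * v' t x)\<bar>
      \<le> 2 * (norm2 (v t) * e s) + \<bar>s - t\<bar> * (e s + norm2 (v' t))\<^sup>2" if s: "s \<in> I" "s \<noteq> t" for s
  proof -
    let ?D = "\<lambda>x. q s x - v' t x"
    have DL2: "?D \<in> L2"
      by (intro L2_diff qL2 L2 s t)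
    have vs: "v s x = v t x + (s - t) * q s x" for x
      using s by (simp add: q_def)
    have quotient: "(X - Y) / r - 2 * B = 2 * A + r * C"
      if "X = Y + (2 * r) * A + (2 * r) * B + r\<^sup>2 * C" "r \<noteq> 0" for X Y A B C r :: real
      using that by (simp add: field_simps power2_eq_square)
    have "(norm2 (v s))\<^sup>2 = (LINT x|unit_lebesgue. (v t x)\<^sup>2 + (2 * (s - t)) * (v t x * ?D x)
        + (2 * (s - t)) * (v t x * v' t x) + (s - t)\<^sup>2 * (q s x)\<^sup>2)"
      unfolding norm2_sq vs by (simp add: power2_eq_square algebra_simps)
    also have "\<dots> = (norm2 (v t))\<^sup>2 + (2 * (s - t)) * (LINT x|unit_lebesgue. v t x * ?D x)
        + (2 * (s - t)) * (LINT x|unit_lebesgue. v t x * v' t x) + (s - t)\<^sup>2 * (norm2 (q s))\<^sup>2"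
    proof -
      note int = L2_integrable_square[OF L2(1)[OF t]] L2_mult_integrable[OF L2(1)[OF t] DL2]
        L2_mult_integrable[OF L2(1)[OF t] L2(2)[OF t]] L2_integrable_square[OF qL2[OF s(1)]]
      show ?thesis
        unfolding norm2_sq using int by simp
    qed
    finally have eq: "((norm2 (v s))\<^sup>2 - (norm2 (v t))\<^sup>2) / (s - t) - 2 * (LINT x|unit_lebesgue. v t x * v' t x)
        = 2 * (LINT x|unit_lebesgue. v t x * ?D x) + (s - t) * (norm2 (q s))\<^sup>2"
      by (rule quotient) (use s in simp)
    have "\<bar>((norm2 (v s))\<^sup>2 - (norm2 (v t))\<^sup>2) / (s - t) - 2 * (LINT x|unit_lebesgue. v t x * v' t x)\<bar>
        \<le> 2 * \<bar>LINT x|unit_lebesgue. v t x * ?D x\<bar> + \<bar>s - t\<bar> * (norm2 (q s))\<^sup>2"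
      unfolding eq by (rule order_trans[OF abs_triangle_ineq]) (simp add: abs_mult)
    also have "\<dots> \<le> 2 * (norm2 (v t) * e s) + \<bar>s - t\<bar> * (e s + norm2 (v' t))\<^sup>2"
    proof -
      have "norm2 (\<lambda>x. ?D x + v' t x) \<le> norm2 ?D + norm2 (v' t)"
        by (rule norm2_triangle[OF DL2 L2(2)[OF t]])
      then have "norm2 (q s) \<le> e s + norm2 (v' t)"
        unfolding e_def diff_add_cancel .
      then have "(norm2 (q s))\<^sup>2 \<le> (e s + norm2 (v' t))\<^sup>2"
        by (rule power_mono) (rule norm2_nonneg)
      moreover have "\<bar>LINT x|unit_lebesgue. v t x * ?D x\<bar> \<le> norm2 (v t) * e s"
        unfolding e_def by (rule L2_Cauchy_Schwarz[OF L2(1)[OF t] DL2])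
      ultimately show ?thesis
        by (intro add_mono mult_left_mono) auto
    qed
    finally show ?thesis .
  qed
  have "((\<lambda>s. ((norm2 (v s))\<^sup>2 - (norm2 (v t))\<^sup>2) / (s - t) - 2 * (LINT x|unit_lebesgue. v t x * v' t x))
      \<longlongrightarrow> 0) (at t within I)"
  proof (rule Lim_null_comparison)
    show "\<forall>\<^sub>F s in at t within I.
        norm (((norm2 (v s))\<^sup>2 - (norm2 (v t))\<^sup>2) / (s - t) - 2 * (LINT x|unit_lebesgue. v t x * v' t x))
        \<le> 2 * (norm2 (v t) * e s) + \<bar>s - t\<bar> * (e s + norm2 (v' t))\<^sup>2"
      unfolding eventually_at_filter real_norm_def
      by (intro always_eventually allI impI bound)
    show "((\<lambda>s. 2 * (norm2 (v t) * e s) + \<bar>s - t\<bar> * (e s + norm2 (v' t))\<^sup>2) \<longlongrightarrow> 0) (at t within I)"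
    proof -
      have "((\<lambda>s. 2 * (norm2 (v t) * e s) + \<bar>s - t\<bar> * (e s + norm2 (v' t))\<^sup>2)
          \<longlongrightarrow> 2 * (norm2 (v t) * 0) + \<bar>t - t\<bar> * (0 + norm2 (v' t))\<^sup>2) (at t within I)"
        by (intro tendsto_intros e0)
      then show ?thesis by simp
    qed
  qed
  then show ?thesis
    unfolding has_field_derivative_iff by (rule LIM_zero_cancel)
qed

section \<open>Integrals over parts of the unit interval\<close>

lemma LINT_eq_integral_subinterval:
  fixes F :: "real \<Rightarrow> real"
  assumes "0 < p" "q < 1" and F: "continuous_on {p..q} F"
    and zero: "\<And>x. x \<in> {0<..<1} \<Longrightarrow> x \<notin> {p..q} \<Longrightarrow> G x = 0"
    and eq: "\<And>x. x \<in> {p..q} \<Longrightarrow> G x = F x"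
  shows "integrable unit_lebesgue G" "(LINT x|unit_lebesgue. G x) = integral {p..q} F"
proof -
  have sub: "{p..q} \<subseteq> {0<..<1}" using assms by auto
  have G: "G x = (if x \<in> {p..q} then F x else 0)" if "x \<in> space unit_lebesgue" for x
    using that zero eq by auto
  have F': "integrable (lebesgue_on {p..q}) F"
    by (rule continuous_imp_integrable_real[OF F])
  have "integrable lebesgue (\<lambda>x. if x \<in> {p..q} then F x else 0)"
    using F' by (subst Lebesgue_Measure.integrable_restrict_UNIV) auto
  moreover have "(\<lambda>x. if x \<in> {p..q} then F x else 0) =
      (\<lambda>x. if x \<in> {0<..<1} then (if x \<in> {p..q} then F x else 0) else 0)"
  proof (rule ext)
    fix x
    have "x \<in> {p..q} \<Longrightarrow> x \<in> {0<..<1}" using sub by blast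
    then show "(if x \<in> {p..q} then F x else 0) =
        (if x \<in> {0<..<1} then (if x \<in> {p..q} then F x else 0) else 0)"
      by presburger
  qed
  ultimately have "integrable unit_lebesgue (\<lambda>x. if x \<in> {p..q} then F x else 0)"
    using Lebesgue_Measure.integrable_restrict_UNIV
      [of "{0<..<1}" "\<lambda>x. if x \<in> {p..q} then F x else 0"] by (metis lmeasurable_interval(2) fmeasurableD)
  then show "integrable unit_lebesgue G"
    by (subst Bochner_Integration.integrable_cong[OF refl G])
  have "(LINT x|unit_lebesgue. G x) = (LINT x|unit_lebesgue. (if x \<in> {p..q} then F x else 0))"
    by (rule Bochner_Integration.integral_cong[OF refl G])
  also have "\<dots> = (LINT x|lebesgue_on {p..q}. F x)"
    by (rule Lebesgue_Measure.integral_restrict[OF sub]) auto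
  also have "\<dots> = integral {p..q} F"
    by (rule lebesgue_integral_eq_integral[OF F']) simp
  finally show "(LINT x|unit_lebesgue. G x) = integral {p..q} F" .
qed

lemma unit_integrable_subset:
  assumes w: "integrable unit_lebesgue w" and S: "S \<subseteq> {0<..<1}" "S \<in> sets lebesgue"
  shows "integrable (lebesgue_on S) w"
    and "w integrable_on S"
    and "(LINT s|unit_lebesgue. indicator S s * w s) = integral S (w :: real \<Rightarrow> real)"
proof -
  have "set_integrable lebesgue {0<..<1} w"
    using w by (simp add: set_integrable_def integrable_restrict_space)
  then have "set_integrable lebesgue S w"
    by (rule set_integrable_subset[OF _ S(2,1)])
  then show int: "integrable (lebesgue_on S) w"
    using S by (simp add: set_integrable_def integrable_restrict_space)
  then show "w integrable_on S"
    by (rule integrable_on_lebesgue_on[OF _ S(2)])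
  have eq: "(\<lambda>s. indicator S s * w s) = (\<lambda>s. if s \<in> S then w s else 0)"
    by (rule ext) (simp add: indicator_def)
  have "(LINT s|unit_lebesgue. (if s \<in> S then w s else 0)) = (LINT s|lebesgue_on S. w s)"
    by (rule Lebesgue_Measure.integral_restrict[OF S]) simp
  also have "\<dots> = integral S w"
    by (rule lebesgue_integral_eq_integral[OF int S(2)])
  finally show "(LINT s|unit_lebesgue. indicator S s * w s) = integral S w"
    unfolding eq .
qed

lemma unit_integral_continuous:
  assumes "continuous_on {0..1} f"
  shows "integrable unit_lebesgue f" "(LINT s|unit_lebesgue. f s) = integral {0..1} (f :: real \<Rightarrow> real)"
proof -
  have "set_integrable lebesgue {0..1} f"
    by (rule absolutely_integrable_continuous_real[OF assms])
  then have "set_integrable lebesgue {0<..<1} f"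
    by (rule set_integrable_subset) auto
  then show int: "integrable unit_lebesgue f"
    by (simp add: set_integrable_def integrable_restrict_space)
  have "(LINT s|unit_lebesgue. f s) = integral {0<..<1} f"
    by (rule lebesgue_integral_eq_integral[OF int]) simp
  then show "(LINT s|unit_lebesgue. f s) = integral {0..1} f"
    by (simp add: integral_open_interval_real)
qed

lemma L2_continuous:
  assumes "continuous_on {0..1} v"
  shows "v \<in> L2"
  unfolding L2_def
  using unit_integral_continuous(1)[OF assms] unit_integral_continuous(1)[of "\<lambda>x. (v x)\<^sup>2"] assms
  by (auto intro: continuous_on_power)

lemma norm2_continuous:
  assumes "continuous_on {0..1} v"
  shows "(norm2 v)\<^sup>2 = integral {0..1} (\<lambda>x. (v x)\<^sup>2)"
  unfolding norm2_sq by (intro unit_integral_continuous continuous_on_power assms)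

text \<open>
  The intervals from \<open>unit_cut n\<close> to \<open>1 - unit_cut n\<close> exhaust the open unit interval; with the offset 3
  they are nondegenerate from \<open>n = 0\<close> on.
\<close>

definition unit_cut :: "nat \<Rightarrow> real" where
  "unit_cut n = 1 / (real n + 3)"

lemma unit_cut_bounds: "0 < unit_cut n" "unit_cut n < 1 / 2"
  by (simp_all add: unit_cut_def field_simps)

lemma unit_cut_tendsto: "unit_cut \<longlonglongrightarrow> 0"
  unfolding unit_cut_def[abs_def]
  by (rule real_tendsto_divide_at_top[OF tendsto_const])
    (auto intro!: filterlim_tendsto_add_at_top[OF tendsto_const filterlim_real_sequentially]
      simp: add.commute[of _ 3])

lemma unit_integral_cut_tendsto:
  assumes w: "integrable unit_lebesgue w"
  shows "(\<lambda>n. integral {unit_cut n..1 - unit_cut n} w) \<longlonglongrightarrow> (LINT s|unit_lebesgue. (w s :: real))"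
proof -
  have S: "{unit_cut n..1 - unit_cut n} \<subseteq> {0<..<1}" "{unit_cut n..1 - unit_cut n} \<in> sets lebesgue" for n
    using unit_cut_bounds[of n] by auto
  have "(\<lambda>n. LINT s|unit_lebesgue. indicat_real {unit_cut n..1 - unit_cut n} s * w s)
      \<longlonglongrightarrow> (LINT s|unit_lebesgue. w s)"
  proof (rule integral_dominated_convergence[where w = "\<lambda>s. \<bar>w s\<bar>"])
    have [measurable]: "w \<in> borel_measurable unit_lebesgue"
      using w by simp
    have [measurable]: "indicat_real {unit_cut n..1 - unit_cut n} \<in> borel_measurable unit_lebesgue" for n
      by (intro measurable_restrict_space1 borel_measurable_indicator) simp
    show "(\<lambda>s. indicat_real {unit_cut n..1 - unit_cut n} s * w s) \<in> borel_measurable unit_lebesgue" for n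
      by measurable
    show "AE s in unit_lebesgue. norm (indicat_real {unit_cut n..1 - unit_cut n} s * w s) \<le> \<bar>w s\<bar>" for n
      by (intro AE_I2) (simp add: indicator_def)
    show "AE s in unit_lebesgue. (\<lambda>n. indicat_real {unit_cut n..1 - unit_cut n} s * w s) \<longlonglongrightarrow> w s"
    proof (intro AE_I2 tendsto_eventually)
      fix s assume "s \<in> space unit_lebesgue"
      then have "0 < min s (1 - s)" by simp
      from order_tendstoD(2)[OF unit_cut_tendsto this]
      show "\<forall>\<^sub>F n in sequentially. indicat_real {unit_cut n..1 - unit_cut n} s * w s = w s"
        by eventually_elim simp
    qed
  qed (use w in auto)
  then show ?thesis
    unfolding unit_integrable_subset(3)[OF w S] .
qed

section \<open>A smooth step and smoothed indicator functions\<close>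

text \<open>
  A smooth step is the source of the test functions used below. Differentiability
  of order \<open>n\<close> is phrased by recursion rather than with iterates of \<open>deriv\<close>, so that closure under
  products and reciprocals is a short induction.
\<close>

fun has_derivs :: "nat \<Rightarrow> (real \<Rightarrow> real) \<Rightarrow> bool" where
  "has_derivs 0 f \<longleftrightarrow> True"
| "has_derivs (Suc n) f \<longleftrightarrow> (\<exists>f'. (\<forall>x. (f has_real_derivative f' x) (at x)) \<and> has_derivs n f')"

lemma has_derivs_SucE:
  assumes "has_derivs (Suc n) f"
  obtains f' where "\<And>x. (f has_real_derivative f' x) (at x)" "has_derivs n f'"
  using assms unfolding has_derivs.simps by blast

lemma has_derivs_SucI:
  "(\<And>x. (f has_real_derivative f' x) (at x)) \<Longrightarrow> has_derivs n f' \<Longrightarrow> has_derivs (Suc n) f"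
  unfolding has_derivs.simps by blast

declare has_derivs.simps(2) [simp del]

lemma has_derivs_pred: "has_derivs (Suc n) f \<Longrightarrow> has_derivs n f"
proof (induction n arbitrary: f)
  case (Suc n)
  from Suc.prems show ?case
    by (rule has_derivs_SucE) (rule has_derivs_SucI, assumption, rule Suc.IH)
qed simp

lemma has_derivs_const: "has_derivs n (\<lambda>x. r)"
proof (induction n arbitrary: r)
  case (Suc n)
  show ?case
    by (rule has_derivs_SucI[OF DERIV_const Suc])
qed simp

lemma has_derivs_add:
  "has_derivs n f \<Longrightarrow> has_derivs n g \<Longrightarrow> has_derivs n (\<lambda>x. f x + g x)"
proof (induction n arbitrary: f g)
  case (Suc n)
  obtain f' where f': "\<And>x. (f has_real_derivative f' x) (at x)" "has_derivs n f'"
    by (rule has_derivs_SucE[OF Suc.prems(1)]) (rule that)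
  obtain g' where g': "\<And>x. (g has_real_derivative g' x) (at x)" "has_derivs n g'"
    by (rule has_derivs_SucE[OF Suc.prems(2)]) (rule that)
  show ?case
    by (rule has_derivs_SucI[OF DERIV_add[OF f'(1) g'(1)] Suc.IH[OF f'(2) g'(2)]])
qed simp

lemma has_derivs_mult:
  "has_derivs n f \<Longrightarrow> has_derivs n g \<Longrightarrow> has_derivs n (\<lambda>x. f x * g x)"
proof (induction n arbitrary: f g)
  case (Suc n)
  obtain f' where f': "\<And>x. (f has_real_derivative f' x) (at x)" "has_derivs n f'"
    by (rule has_derivs_SucE[OF Suc.prems(1)]) (rule that)
  obtain g' where g': "\<And>x. (g has_real_derivative g' x) (at x)" "has_derivs n g'"
    by (rule has_derivs_SucE[OF Suc.prems(2)]) (rule that)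
  have "has_derivs n (\<lambda>x. f' x * g x + g' x * f x)"
    by (rule has_derivs_add[OF Suc.IH[OF f'(2) has_derivs_pred[OF Suc.prems(2)]]
          Suc.IH[OF g'(2) has_derivs_pred[OF Suc.prems(1)]]])
  with DERIV_mult[OF f'(1) g'(1)] show ?case
    by (rule has_derivs_SucI)
qed simp

lemma has_derivs_inverse:
  "has_derivs n f \<Longrightarrow> (\<And>x. f x \<noteq> 0) \<Longrightarrow> has_derivs n (\<lambda>x. inverse (f x))"
proof (induction n arbitrary: f)
  case (Suc n)
  obtain f' where f': "\<And>x. (f has_real_derivative f' x) (at x)" "has_derivs n f'"
    by (rule has_derivs_SucE[OF Suc.prems(1)]) (rule that)
  have inv: "has_derivs n (\<lambda>x. inverse (f x))"
    by (rule Suc.IH[OF has_derivs_pred[OF Suc.prems(1)] Suc.prems(2)])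
  have "has_derivs n (\<lambda>x. (-1) * (inverse (f x) * f' x * inverse (f x)))"
    by (intro has_derivs_mult has_derivs_const inv f')
  then have "has_derivs n (\<lambda>x. - (inverse (f x) * f' x * inverse (f x)))"
    by simp
  with DERIV_inverse'[OF f'(1) Suc.prems(2)] show ?case
    by (rule has_derivs_SucI)
qed simp

lemma has_derivs_affine: "has_derivs n f \<Longrightarrow> has_derivs n (\<lambda>x. f (r * x + s))"
proof (induction n arbitrary: f)
  case (Suc n)
  obtain f' where f': "\<And>x. (f has_real_derivative f' x) (at x)" "has_derivs n f'"
    by (rule has_derivs_SucE[OF Suc.prems]) (rule that)
  have "has_derivs n (\<lambda>x. f' (r * x + s) * r)"
    by (intro has_derivs_mult has_derivs_const Suc.IH f')
  moreover have "((\<lambda>x. r * x + s) has_real_derivative r) (at x)" for x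
    by (auto intro!: derivative_eq_intros)
  ultimately show ?case
    by (intro has_derivs_SucI[OF DERIV_chain2[OF f'(1)]])
qed simp

lemma has_derivs_differentiable:
  "has_derivs (Suc n) f \<Longrightarrow> (deriv ^^ n) f differentiable_on UNIV"
proof (induction n arbitrary: f)
  case 0
  then obtain f' where "\<And>x. (f has_real_derivative f' x) (at x)"
    by (rule has_derivs_SucE) (rule that)
  then have "f differentiable (at x)" for x
    using real_differentiable_def by blast
  then show ?case
    by (simp add: differentiable_on_def)
next
  case (Suc n)
  obtain f' where f': "\<And>x. (f has_real_derivative f' x) (at x)" "has_derivs (Suc n) f'"
    by (rule has_derivs_SucE[OF Suc.prems]) (rule that)
  have "deriv f = f'"
    by (rule ext) (rule DERIV_imp_deriv[OF f'(1)])
  then show ?case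
    using Suc.IH[OF f'(2)] by (simp add: funpow_swap1)
qed

text \<open>
  This family extends \<open>exp (- 1 / x)\<close> by zero, multiplied by powers of \<open>1 / x\<close>. Its linear span is
  closed under differentiation, also at 0, which gives derivatives of all orders at once.
\<close>

definition flat_exp :: "nat \<Rightarrow> real \<Rightarrow> real" where
  "flat_exp n x = (if x > 0 then exp (- inverse x) * inverse x ^ n else 0)"

lemma flat_exp_tendsto_0: "(flat_exp n \<longlongrightarrow> 0) (at 0)"
proof (rule filterlim_split_at)
  show "(flat_exp n \<longlongrightarrow> 0) (at_left 0)"
    by (rule tendsto_eventually) (auto simp: eventually_at_filter flat_exp_def)
  have "((\<lambda>x::real. inverse x ^ n / exp (inverse x)) \<longlongrightarrow> 0) (at_right 0)"
    by (rule filterlim_compose[OF tendsto_power_div_exp_0 filterlim_inverse_at_top_right])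
  then show "(flat_exp n \<longlongrightarrow> 0) (at_right 0)"
    by (rule Lim_transform_eventually)
      (auto simp: eventually_at_filter flat_exp_def exp_minus field_simps)
qed

lemma flat_exp_deriv:
  "(flat_exp n has_real_derivative - real n * flat_exp (Suc n) x + flat_exp (n + 2) x) (at x)"
proof (rule linorder_cases[of x 0])
  assume "x < 0"
  have "(flat_exp n has_real_derivative 0) (at x)"
    by (rule has_field_derivative_transform_within_open[of "\<lambda>_. 0" 0 x "{..<0}"])
      (use \<open>x < 0\<close> in \<open>auto simp: flat_exp_def\<close>)
  then show ?thesis using \<open>x < 0\<close> by (simp add: flat_exp_def)
next
  assume "x = 0"
  have "((\<lambda>y. (flat_exp n y - flat_exp n 0) / (y - 0)) \<longlongrightarrow> 0) (at 0)"
    by (rule Lim_transform_eventually[OF flat_exp_tendsto_0[of "Suc n"]])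
      (auto simp: eventually_at_filter flat_exp_def field_simps)
  then show ?thesis
    using \<open>x = 0\<close> by (simp add: flat_exp_def has_field_derivative_iff)
next
  assume "0 < x"
  have "((\<lambda>y. exp (- inverse y) * inverse y ^ n) has_real_derivative
      - real n * flat_exp (Suc n) x + flat_exp (n + 2) x) (at x)"
  proof -
    have inv: "(inverse has_real_derivative - (inverse x)\<^sup>2) (at x)"
      using DERIV_inverse[of x] \<open>0 < x\<close> by (simp add: numeral_2_eq_2)
    have power: "real n * (inverse x ^ (n - Suc 0) * - (inverse x)\<^sup>2) = - real n * inverse x ^ Suc n"
      by (cases n) (simp_all add: power2_eq_square algebra_simps)
    have "((\<lambda>y. inverse y ^ n) has_real_derivative - real n * inverse x ^ Suc n) (at x)"
      using DERIV_power[OF inv, of n] power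
      by (metis (no_types, lifting) mult.commute)
    from DERIV_mult[OF DERIV_fun_exp[OF DERIV_minus[OF inv]] this] show ?thesis
      using \<open>0 < x\<close> by (simp add: flat_exp_def power2_eq_square algebra_simps)
  qed
  then show ?thesis
    by (rule has_field_derivative_transform_within_open[of _ _ _ "{0<..}"])
      (use \<open>0 < x\<close> in \<open>auto simp: flat_exp_def\<close>)
qed

lemma flat_exp_has_derivs: "has_derivs m (flat_exp n)"
proof (induction m arbitrary: n)
  case (Suc m)
  have "has_derivs m (\<lambda>x. - real n * flat_exp (Suc n) x + flat_exp (n + 2) x)"
    by (intro has_derivs_add has_derivs_mult has_derivs_const Suc)
  then show ?case
    by (rule has_derivs_SucI[OF flat_exp_deriv])
qed simp

definition smooth_step :: "real \<Rightarrow> real" where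
  "smooth_step x = flat_exp 0 x * inverse (flat_exp 0 x + flat_exp 0 (1 - x))"

lemma flat_exp_sum_pos: "0 < flat_exp 0 x + flat_exp 0 (1 - x)"
  by (auto simp: flat_exp_def add_pos_pos)

lemma smooth_step_has_derivs: "has_derivs m smooth_step"
proof -
  have "has_derivs m (\<lambda>x. flat_exp 0 ((-1) * x + 1))"
    by (intro has_derivs_affine flat_exp_has_derivs)
  then have "has_derivs m (\<lambda>x. flat_exp 0 x + flat_exp 0 (1 - x))"
    by (intro has_derivs_add flat_exp_has_derivs) simp
  then have "has_derivs m (\<lambda>x. flat_exp 0 x * inverse (flat_exp 0 x + flat_exp 0 (1 - x)))"
    using flat_exp_sum_pos by (intro has_derivs_mult has_derivs_inverse flat_exp_has_derivs)
      (auto simp: less_imp_neq[symmetric])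
  then show ?thesis
    unfolding smooth_step_def[abs_def] .
qed

lemma smooth_step_bounds: "0 \<le> smooth_step x" "smooth_step x \<le> 1"
proof -
  have "0 \<le> flat_exp 0 x" "0 \<le> flat_exp 0 (1 - x)"
    by (auto simp: flat_exp_def)
  then show "0 \<le> smooth_step x" "smooth_step x \<le> 1"
    using flat_exp_sum_pos[of x] by (auto simp: smooth_step_def field_simps)
qed

lemma smooth_step_0: "x \<le> 0 \<Longrightarrow> smooth_step x = 0"
  by (simp add: smooth_step_def flat_exp_def)

lemma smooth_step_1: "1 \<le> x \<Longrightarrow> smooth_step x = 1"
  by (simp add: smooth_step_def flat_exp_def)

lemma smooth_step_deriv: "(smooth_step has_real_derivative deriv smooth_step x) (at x)"
proof -
  obtain f' where "\<And>x. (smooth_step has_real_derivative f' x) (at x)"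
    by (rule has_derivs_SucE[OF smooth_step_has_derivs]) (rule that)
  then show ?thesis
    using DERIV_imp_deriv by metis
qed

lemma continuous_deriv_smooth_step: "continuous_on A (deriv smooth_step)"
proof -
  obtain f' where f': "\<And>x. (smooth_step has_real_derivative f' x) (at x)" "has_derivs (Suc 0) f'"
    by (rule has_derivs_SucE[OF smooth_step_has_derivs]) (rule that)
  obtain f'' where f'': "\<And>x. (f' has_real_derivative f'' x) (at x)"
    by (rule has_derivs_SucE[OF f'(2)]) (rule that)
  have "deriv smooth_step = f'"
    by (rule ext) (rule DERIV_imp_deriv[OF f'(1)])
  then show ?thesis
    using DERIV_isCont[OF f''] by (simp add: continuous_at_imp_continuous_on)
qed

lemma deriv_smooth_step_outside:
  assumes "x < 0 \<or> 1 < x"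
  shows "deriv smooth_step x = 0"
  using assms
proof
  assume "x < 0"
  have "(smooth_step has_real_derivative 0) (at x)"
    by (rule has_field_derivative_transform_within_open[of "\<lambda>_. 0" 0 x "{..<0}"])
      (use \<open>x < 0\<close> in \<open>auto simp: smooth_step_0\<close>)
  then show ?thesis by (rule DERIV_imp_deriv)
next
  assume "1 < x"
  have "(smooth_step has_real_derivative 0) (at x)"
    by (rule has_field_derivative_transform_within_open[of "\<lambda>_. 1" 0 x "{1<..}"])
      (use \<open>1 < x\<close> in \<open>auto simp: smooth_step_1\<close>)
  then show ?thesis by (rule DERIV_imp_deriv)
qed

text \<open>
  A smooth plateau that rises from 0 to 1 on \<open>[x, x + 1/n]\<close> and falls back on \<open>[y, y + 1/n]\<close>, thus
  a smoothed indicator of the interval from \<open>x\<close> to \<open>y\<close>.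
\<close>

definition plateau :: "real \<Rightarrow> real \<Rightarrow> real \<Rightarrow> real \<Rightarrow> real" where
  "plateau n x y s = smooth_step (n * s + - n * x) - smooth_step (n * s + - n * y)"

lemma plateau_deriv:
  "(plateau n x y has_real_derivative
     n * deriv smooth_step (n * s + - n * x) - n * deriv smooth_step (n * s + - n * y)) (at s)"
proof -
  have "((\<lambda>s. smooth_step (n * s + r)) has_real_derivative n * deriv smooth_step (n * s + r)) (at s)"
    for r
  proof -
    have "((\<lambda>s. n * s + r) has_real_derivative n) (at s)"
      by (auto intro!: derivative_eq_intros)
    from DERIV_chain2[OF smooth_step_deriv this] show ?thesis by (simp add: mult.commute)
  qed
  then show ?thesis
    unfolding plateau_def[abs_def] by (intro DERIV_diff)
qed

lemma plateau_outside:
  assumes "0 < n" "x \<le> y" "s \<le> x \<or> y + 1 / n \<le> s"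
  shows "plateau n x y s = 0"
  using assms(3)
proof
  assume "s \<le> x"
  then have "n * s \<le> n * x" "n * s \<le> n * y"
    using assms by (auto intro!: mult_left_mono)
  then show ?thesis by (simp add: plateau_def smooth_step_0)
next
  assume "y + 1 / n \<le> s"
  then have "n * (y + 1 / n) \<le> n * s" "n * x \<le> n * y"
    using assms by (auto intro!: mult_left_mono)
  moreover have "n * (y + 1 / n) = n * y + 1"
    using assms(1) by (simp add: distrib_left)
  ultimately have "1 \<le> n * s + - n * x" "1 \<le> n * s + - n * y"
    by linarith+
  then show ?thesis by (simp only: plateau_def smooth_step_1)
qed

lemma plateau_bound: "\<bar>plateau n x y s\<bar> \<le> 1"
  using smooth_step_bounds[of "n * s + - n * x"] smooth_step_bounds[of "n * s + - n * y"]
  unfolding plateau_def by linarith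

lemma test_function_plateau:
  assumes "0 < n" "0 < x" "x \<le> y" "y + 1 / n < 1"
  shows "test_function (plateau n x y)"
  unfolding test_function_def
proof (intro conjI allI)
  fix m
  have "has_derivs (Suc m) (\<lambda>s. smooth_step (n * s + - n * x) + (-1) * smooth_step (n * s + - n * y))"
    by (intro has_derivs_add has_derivs_mult has_derivs_const has_derivs_affine smooth_step_has_derivs)
  then have "has_derivs (Suc m) (plateau n x y)"
    unfolding plateau_def[abs_def] by simp
  then show "(deriv ^^ m) (plateau n x y) differentiable_on UNIV"
    by (rule has_derivs_differentiable)
next
  have "compact {x..y + 1 / n}" "{x..y + 1 / n} \<subseteq> {0<..<1}"
    using assms by auto
  moreover have "\<forall>s. s \<notin> {x..y + 1 / n} \<longrightarrow> plateau n x y s = 0"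
    using plateau_outside[OF assms(1,3)] by auto
  ultimately show "\<exists>K. compact K \<and> K \<subseteq> {0<..<1} \<and> (\<forall>s. s \<notin> K \<longrightarrow> plateau n x y s = 0)"
    by blast
qed

lemma plateau_tendsto:
  assumes "x \<le> y"
  shows "((\<lambda>n. plateau n x y s) \<longlongrightarrow> indicat_real {x<..y} s) at_top"
proof -
  have step: "((\<lambda>n. smooth_step (n * s + - n * r)) \<longlongrightarrow> (if r < s then 1 else 0)) at_top" for r
  proof (rule tendsto_eventually)
    show "\<forall>\<^sub>F n in at_top. smooth_step (n * s + - n * r) = (if r < s then 1 else 0)"
    proof (cases "r < s")
      case True
      show ?thesis
        using eventually_ge_at_top[of "1 / (s - r)"]
      proof eventually_elim
        case (elim n)
        then have "1 \<le> n * (s - r)" using True by (simp add: pos_divide_le_eq)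
        then show ?case using True by (simp add: smooth_step_1 algebra_simps)
      qed
    next
      case False
      show ?thesis
        using eventually_ge_at_top[of 0]
      proof eventually_elim
        case (elim n)
        then have "n * s \<le> n * r" using False by (intro mult_left_mono) auto
        then show ?case using False by (simp add: smooth_step_0)
      qed
    qed
  qed
  have "indicat_real {x<..y} s = (if x < s then 1 else 0) - (if y < s then 1 else 0)"
    using assms by (auto simp: indicator_def)
  then show ?thesis
    unfolding plateau_def using tendsto_diff[OF step[of x] step[of y]] by simp
qed

text \<open>The derivative of one flank of a plateau, an approximate identity at \<open>x\<close> as \<open>n \<rightarrow> \<infinity>\<close>.\<close>

definition bump_kernel :: "real \<Rightarrow> real \<Rightarrow> real \<Rightarrow> real" where
  "bump_kernel n x s = n * deriv smooth_step (n * s + - n * x)"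

lemma kernel_continuous: "continuous_on A (bump_kernel n x)"
  unfolding bump_kernel_def
  by (intro continuous_intros continuous_on_compose2[OF continuous_deriv_smooth_step]) auto

lemma kernel_outside:
  assumes "0 < n" "s \<notin> {x..x + 1 / n}"
  shows "bump_kernel n x s = 0"
proof -
  have "s < x \<or> x + 1 / n < s" using assms by auto
  then have "n * s < n * x \<or> n * (x + 1 / n) < n * s"
    using assms(1) by auto
  moreover have "n * (x + 1 / n) = n * x + 1"
    using assms(1) by (simp add: distrib_left)
  ultimately have "n * s + - n * x < 0 \<or> 1 < n * s + - n * x" by auto
  then show ?thesis by (simp add: bump_kernel_def deriv_smooth_step_outside)
qed

lemma deriv_plateau: "deriv (plateau n x y) s = bump_kernel n x s - bump_kernel n y s"
  unfolding bump_kernel_def by (rule DERIV_imp_deriv) (rule plateau_deriv)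

lemma kernel_integral:
  assumes "0 < n"
  shows "integral {x..x + 1 / n} (bump_kernel n x) = 1"
proof -
  have "((\<lambda>s. smooth_step (n * s + - n * x)) has_real_derivative bump_kernel n x s) (at s)" for s
  proof -
    have "((\<lambda>s. n * s + - n * x) has_real_derivative n) (at s)"
      by (auto intro!: derivative_eq_intros)
    from DERIV_chain2[OF smooth_step_deriv this] show ?thesis
      by (simp add: bump_kernel_def mult.commute)
  qed
  then have "(bump_kernel n x has_integral
      smooth_step (n * (x + 1 / n) + - n * x) - smooth_step (n * x + - n * x)) {x..x + 1 / n}"
    using assms
    by (intro fundamental_theorem_of_calculus)
      (auto simp: has_real_derivative_iff_has_vector_derivative[symmetric]
        intro: has_field_derivative_at_within)
  moreover have "n * (x + 1 / n) + - n * x = 1"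
    using assms by (simp add: distrib_left)
  ultimately show ?thesis
    by (simp add: smooth_step_0 smooth_step_1 integral_unique)
qed

lemma kernel_bound: "\<exists>B\<ge>0. \<forall>n>0. \<forall>x s. \<bar>bump_kernel n x s\<bar> \<le> n * B"
proof -
  have "bounded (deriv smooth_step ` {0..1})"
    by (intro compact_imp_bounded compact_continuous_image continuous_deriv_smooth_step) simp
  then obtain B where B: "\<forall>r\<in>{0..1}. \<bar>deriv smooth_step r\<bar> \<le> B"
    unfolding bounded_iff by auto
  have "0 \<le> B" using B[rule_format, of 0] by simp
  have "\<bar>deriv smooth_step r\<bar> \<le> B" for r
  proof (cases "r \<in> {0..1}")
    case False
    then have "deriv smooth_step r = 0" by (intro deriv_smooth_step_outside) auto
    then show ?thesis using \<open>0 \<le> B\<close> by simp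
  qed (use B in blast)
  then show ?thesis
    using \<open>0 \<le> B\<close> unfolding bump_kernel_def
    by (intro exI[of _ B]) (auto simp: abs_mult intro!: mult_left_mono)
qed

text \<open>
  The kernel lives on an interval of length \<open>1 / n\<close>, where it has integral 1 and is of order \<open>n\<close>, so
  that only the values of \<open>v\<close> close to \<open>x\<close> count.
\<close>

lemma kernel_approximates:
  assumes v: "continuous_on {0<..<1} v" and x: "0 < x" "x < 1"
  shows "\<forall>\<^sub>F n in at_top. integrable unit_lebesgue (\<lambda>s. v s * bump_kernel n x s)"
    and "((\<lambda>n. LINT s|unit_lebesgue. v s * bump_kernel n x s) \<longlongrightarrow> v x) at_top"
proof -
  have large: "\<forall>\<^sub>F n in at_top. 0 < n \<and> 1 / n < \<delta>" if "0 < \<delta>" for \<delta> :: real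
    using eventually_gt_at_top[of "1 / \<delta>"]
  proof eventually_elim
    case (elim n)
    then have "0 < n" using that by (meson divide_pos_pos less_trans zero_less_one)
    then show ?case using elim that by (simp add: field_simps)
  qed
  have sub: "integrable unit_lebesgue (\<lambda>s. v s * bump_kernel n x s)"
    "(LINT s|unit_lebesgue. v s * bump_kernel n x s) = integral {x..x + 1 / n} (\<lambda>s. v s * bump_kernel n x s)"
    if n: "0 < n" "1 / n < 1 - x" for n
  proof -
    have "continuous_on {x..x + 1 / n} (\<lambda>s. v s * bump_kernel n x s)"
      using n x by (intro continuous_intros kernel_continuous continuous_on_subset[OF v]) auto
    from LINT_eq_integral_subinterval[OF _ _ this, of "\<lambda>s. v s * bump_kernel n x s"]
    show "integrable unit_lebesgue (\<lambda>s. v s * bump_kernel n x s)"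
      "(LINT s|unit_lebesgue. v s * bump_kernel n x s) = integral {x..x + 1 / n} (\<lambda>s. v s * bump_kernel n x s)"
      using n x kernel_outside[OF n(1)] by auto
  qed
  show "\<forall>\<^sub>F n in at_top. integrable unit_lebesgue (\<lambda>s. v s * bump_kernel n x s)"
    using large[of "1 - x"] x sub(1) by (auto elim: eventually_mono)
  obtain B where B: "0 \<le> B" "\<And>n x s. 0 < n \<Longrightarrow> \<bar>bump_kernel n x s\<bar> \<le> n * B"
    using kernel_bound by blast
  show "((\<lambda>n. LINT s|unit_lebesgue. v s * bump_kernel n x s) \<longlongrightarrow> v x) at_top"
  proof (rule tendstoI)
    fix e :: real assume "0 < e"
    define e' where "e' = e / (B + 1)"
    have e': "0 < e'" "e' * B < e" using \<open>0 < e\<close> \<open>0 \<le> B\<close> by (auto simp: e'_def field_simps)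
    have "isCont v x"
      using v x by (simp add: continuous_on_eq_continuous_at)
    then obtain \<delta> where \<delta>: "0 < \<delta>" "\<And>s. \<bar>s - x\<bar> < \<delta> \<Longrightarrow> \<bar>v s - v x\<bar> < e'"
      using e'(1) unfolding continuous_at_eps_delta dist_real_def by blast
    have "\<forall>\<^sub>F n in at_top. 0 < n \<and> 1 / n < min \<delta> (1 - x)"
      using \<delta>(1) x by (intro large) auto
    then show "\<forall>\<^sub>F n in at_top. dist (LINT s|unit_lebesgue. v s * bump_kernel n x s) (v x) < e"
    proof eventually_elim
      case (elim n)
      then have n: "0 < n" "1 / n < \<delta>" "1 / n < 1 - x" by auto
      have cont: "continuous_on {x..x + 1 / n} v"
        using n x by (intro continuous_on_subset[OF v]) auto
      have "(LINT s|unit_lebesgue. v s * bump_kernel n x s) - v x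
          = integral {x..x + 1 / n} (\<lambda>s. v s * bump_kernel n x s)
            - integral {x..x + 1 / n} (\<lambda>s. v x * bump_kernel n x s)"
        using sub(2)[OF n(1,3)] kernel_integral[OF n(1)] by simp
      also have "\<dots> = integral {x..x + 1 / n} (\<lambda>s. v s * bump_kernel n x s - v x * bump_kernel n x s)"
        by (intro Henstock_Kurzweil_Integration.integral_diff[symmetric]
            integrable_continuous_real continuous_intros kernel_continuous cont)
      also have "norm \<dots> \<le> (e' * (n * B)) * (x + 1 / n - x)"
      proof (rule integral_bound)
        show "continuous_on {x..x + 1 / n} (\<lambda>s. v s * bump_kernel n x s - v x * bump_kernel n x s)"
          by (intro continuous_intros kernel_continuous cont)
        fix s assume s: "s \<in> {x..x + 1 / n}"
        have "norm (v s * bump_kernel n x s - v x * bump_kernel n x s) = \<bar>v s - v x\<bar> * \<bar>bump_kernel n x s\<bar>"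
          by (simp add: abs_mult[symmetric] left_diff_distrib)
        also have "\<dots> \<le> e' * (n * B)"
          using s n \<delta>(2)[of s] B(2)[OF n(1), of x s] e'(1) by (intro mult_mono) auto
        finally show "norm (v s * bump_kernel n x s - v x * bump_kernel n x s) \<le> e' * (n * B)" .
      qed (use n in simp)
      also have "\<dots> = e' * B" using n by simp
      finally show ?case using e'(2) by (simp add: dist_real_def)
    qed
  qed
qed

section \<open>Weak derivatives and indefinite integrals\<close>

text \<open>
  Testing with smooth plateaus recovers the fundamental theorem of calculus: the derivatives of the
  two flanks are approximate identities at \<open>x\<close> and \<open>y\<close>, and the plateau converges to the indicator.
\<close>

lemma weak_deriv_integral:
  assumes v: "continuous_on {0<..<1} v" and w: "integrable unit_lebesgue w"
    and weak: "weak_deriv 1 v w" and xy: "0 < x" "x \<le> y" "y < 1"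
  shows "v y - v x = integral {x..y} w"
proof -
  have x1: "x < 1" and y0: "0 < y" using xy by auto
  have lhs: "((\<lambda>n. LINT s|unit_lebesgue. v s * deriv (plateau n x y) s) \<longlongrightarrow> v x - v y) at_top"
  proof (rule Lim_transform_eventually)
    show "((\<lambda>n. (LINT s|unit_lebesgue. v s * bump_kernel n x s) - (LINT s|unit_lebesgue. v s * bump_kernel n y s))
        \<longlongrightarrow> v x - v y) at_top"
      by (intro tendsto_diff kernel_approximates(2) v xy x1 y0)
    show "\<forall>\<^sub>F n in at_top. (LINT s|unit_lebesgue. v s * bump_kernel n x s)
        - (LINT s|unit_lebesgue. v s * bump_kernel n y s)
        = (LINT s|unit_lebesgue. v s * deriv (plateau n x y) s)"
      using kernel_approximates(1)[OF v xy(1) x1] kernel_approximates(1)[OF v y0 xy(3)]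
    proof eventually_elim
      case (elim n)
      then show ?case
        by (simp add: deriv_plateau right_diff_distrib)
    qed
  qed
  have "((\<lambda>n. LINT s|unit_lebesgue. w s * plateau n x y s)
      \<longlongrightarrow> (LINT s|unit_lebesgue. w s * indicat_real {x<..y} s)) at_top"
  proof (rule integral_dominated_convergence_at_top[where w = "\<lambda>s. \<bar>w s\<bar>"])
    have [measurable]: "w \<in> borel_measurable unit_lebesgue"
      using w by simp
    have [measurable]: "plateau n x y \<in> borel_measurable unit_lebesgue" for n
      by (intro continuous_imp_measurable_on_sets_lebesgue DERIV_continuous_on[OF has_field_derivative_at_within[OF plateau_deriv]]) simp
    have [measurable]: "indicat_real {x<..y} \<in> borel_measurable unit_lebesgue"
      by (intro measurable_restrict_space1 borel_measurable_indicator) simp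
    show "(\<lambda>s. w s * indicat_real {x<..y} s) \<in> borel_measurable unit_lebesgue"
      "(\<lambda>s. w s * plateau n x y s) \<in> borel_measurable unit_lebesgue" for n
      by measurable
    show "\<forall>\<^sub>F n in at_top. AE s in unit_lebesgue. norm (w s * plateau n x y s) \<le> \<bar>w s\<bar>"
      using plateau_bound by (intro always_eventually allI AE_I2) (simp add: abs_mult mult_left_le)
    show "AE s in unit_lebesgue. ((\<lambda>n. w s * plateau n x y s) \<longlongrightarrow> w s * indicat_real {x<..y} s) at_top"
      by (intro AE_I2 tendsto_mult tendsto_const plateau_tendsto xy)
  qed (use w in simp)
  then have rhs: "((\<lambda>n. - (LINT s|unit_lebesgue. w s * plateau n x y s)) \<longlongrightarrow>
      - (LINT s|unit_lebesgue. w s * indicat_real {x<..y} s)) at_top"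
    by (rule tendsto_minus)
  have "\<forall>\<^sub>F n in at_top. - (LINT s|unit_lebesgue. w s * plateau n x y s)
      = (LINT s|unit_lebesgue. v s * deriv (plateau n x y) s)"
    using eventually_gt_at_top[of "1 / (1 - y)"]
  proof eventually_elim
    case (elim n)
    have "0 < 1 / (1 - y)" using xy by simp
    then have "0 < n" using elim by linarith
    moreover from this have "y + 1 / n < 1" using elim xy by (simp add: field_simps)
    ultimately have "test_function (plateau n x y)"
      by (intro test_function_plateau xy) auto
    then show ?case
      using weak by (simp add: weak_deriv_def)
  qed
  then have "((\<lambda>n. LINT s|unit_lebesgue. v s * deriv (plateau n x y) s) \<longlongrightarrow>
      - (LINT s|unit_lebesgue. w s * indicat_real {x<..y} s)) at_top"
    by (rule Lim_transform_eventually[OF rhs])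
  then have "v x - v y = - (LINT s|unit_lebesgue. w s * indicat_real {x<..y} s)"
    by (rule tendsto_unique[OF trivial_limit_at_top_linorder lhs])
  also have "(LINT s|unit_lebesgue. w s * indicat_real {x<..y} s) = integral {x<..y} w"
  proof -
    have "{x<..y} \<subseteq> {0<..<1}" using xy by auto
    then show ?thesis
      using unit_integrable_subset(3)[OF w, of "{x<..y}"] by (simp add: mult.commute)
  qed
  also have "integral {x<..y} w = integral {x..y} w"
    by (rule integral_spike_set; rule negligible_subset[of "{x}"]) auto
  finally show ?thesis by simp
qed

lemma weak_deriv_bounded:
  assumes v: "continuous_on {0<..<1} v" and w: "integrable unit_lebesgue w"
    and weak: "weak_deriv 1 v w" and xy: "0 < x" "x \<le> y" "y < 1"
  shows "\<bar>v y - v x\<bar> \<le> (LINT s|unit_lebesgue. \<bar>w s\<bar>)"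
proof -
  have S: "{x..y} \<subseteq> {0<..<1}" "{x..y} \<in> sets lebesgue" using xy by auto
  have abs: "integrable unit_lebesgue (\<lambda>s. \<bar>w s\<bar>)" using w by simp
  have "\<bar>v y - v x\<bar> = \<bar>LINT s|unit_lebesgue. indicator {x..y} s * w s\<bar>"
    unfolding weak_deriv_integral[OF v w weak xy] unit_integrable_subset(3)[OF w S] ..
  also have "\<dots> \<le> (LINT s|unit_lebesgue. \<bar>indicator {x..y} s * w s\<bar>)"
    by (rule integral_abs_bound)
  also have "\<dots> \<le> (LINT s|unit_lebesgue. \<bar>w s\<bar>)"
  proof (rule Bochner_Integration.integral_mono')
    show "\<bar>indicat_real {x..y} s * w s\<bar> \<le> \<bar>w s\<bar>" for s
      by (simp add: indicator_def)
  qed (use abs in auto)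
  finally show ?thesis .
qed

text \<open>
  The bound makes the difference quotients of \<open>F\<close> tend to zero at every point. It replaces
  differentiability almost everywhere in the next lemma, where \<open>G\<close> is the indefinite integral of \<open>\<bar>g\<bar>\<close>.
\<close>

lemma zero_derivative_criterion:
  fixes F G :: "real \<Rightarrow> real"
  assumes G: "continuous_on {p..q} G"
    and F: "\<And>x y. p \<le> x \<Longrightarrow> x \<le> y \<Longrightarrow> y \<le> q \<Longrightarrow> \<bar>F y - F x\<bar> \<le> L * (y - x) * \<bar>G y - G x\<bar>"
    and pq: "p \<le> q"
  shows "F q = F p"
proof -
  have "(F has_real_derivative 0) (at x within {p..q})" if x: "x \<in> {p..q}" for x
    unfolding has_field_derivative_iff
  proof (rule Lim_null_comparison)
    have *: "norm ((F y - F x) / (y - x)) \<le> \<bar>L\<bar> * \<bar>G y - G x\<bar>" if y: "y \<in> {p..q}" "y \<noteq> x" for y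
    proof -
      have "\<bar>F y - F x\<bar> \<le> L * \<bar>y - x\<bar> * \<bar>G y - G x\<bar>"
        using F[of x y] F[of y x] x y by (cases "x \<le> y") (auto simp: abs_minus_commute)
      also have "\<dots> \<le> \<bar>L\<bar> * \<bar>y - x\<bar> * \<bar>G y - G x\<bar>"
        by (intro mult_right_mono) auto
      finally show ?thesis
        using y by (simp add: field_simps)
    qed
    then show "\<forall>\<^sub>F y in at x within {p..q}. norm ((F y - F x) / (y - x)) \<le> \<bar>L\<bar> * \<bar>G y - G x\<bar>"
      unfolding eventually_at_filter by (intro always_eventually) blast
    have "((\<lambda>y. \<bar>L\<bar> * \<bar>G y - G x\<bar>) \<longlongrightarrow> \<bar>L\<bar> * \<bar>G x - G x\<bar>) (at x within {p..q})"
      using G x by (intro tendsto_intros) (simp add: continuous_on_def)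
    then show "((\<lambda>y. \<bar>L\<bar> * \<bar>G y - G x\<bar>) \<longlongrightarrow> 0) (at x within {p..q})"
      by simp
  qed
  then have "\<forall>x\<in>{p..q}. (F has_derivative (\<lambda>h. 0)) (at x within {p..q})"
    by (auto simp: has_field_derivative_def lambda_zero)
  then obtain c where "\<forall>x\<in>{p..q}. F x = c"
    using has_derivative_zero_constant[of "{p..q}" F] by auto
  then show ?thesis using pq by simp
qed

text \<open>
  The two sides, as functions \<open>F\<close> of the upper end point, agree up to increments
  \<open>\<integral> (g s (v s - v x) + z s (W s - W y)) ds\<close> over \<open>[x, y]\<close>. Since \<open>v\<close> is Lipschitz continuous and the
  increments of \<open>W\<close> are bounded by those of \<open>\<integral> \<bar>g\<bar>\<close>, this is of smaller order than \<open>y - x\<close>.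
\<close>

lemma integration_by_parts_indefinite:
  fixes v z W g :: "real \<Rightarrow> real"
  assumes pq: "p \<le> q" and z: "continuous_on {p..q} z" and W: "continuous_on {p..q} W"
    and v: "\<And>x y. p \<le> x \<Longrightarrow> x \<le> y \<Longrightarrow> y \<le> q \<Longrightarrow> v y - v x = integral {x..y} z"
    and Wg: "\<And>x y. p \<le> x \<Longrightarrow> x \<le> y \<Longrightarrow> y \<le> q \<Longrightarrow> W y - W x = integral {x..y} g"
    and g: "g absolutely_integrable_on {p..q}" and gv: "(\<lambda>s. g s * v s) integrable_on {p..q}"
  shows "integral {p..q} (\<lambda>s. g s * v s) = v q * W q - v p * W p - integral {p..q} (\<lambda>s. z s * W s)"
proof -
  have "bounded (z ` {p..q})"
    by (intro compact_imp_bounded compact_continuous_image z) simp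
  then obtain L where "\<forall>r\<in>z ` {p..q}. norm r \<le> L"
    unfolding bounded_iff by blast
  then have L: "\<bar>z x\<bar> \<le> L" if "x \<in> {p..q}" for x
    using that by simp
  have "0 \<le> L"
    using order_trans[OF abs_ge_zero L[of p]] pq by simp
  have g_int: "g integrable_on {p..q}" and ag_int: "(\<lambda>s. \<bar>g s\<bar>) integrable_on {p..q}"
    using g unfolding absolutely_integrable_on_def real_norm_def by blast+
  have v_lip: "\<bar>v y - v x\<bar> \<le> L * (y - x)" if "p \<le> x" "x \<le> y" "y \<le> q" for x y
    unfolding v[OF that] real_norm_def[symmetric] using that
    by (intro integral_bound continuous_on_subset[OF z]) (auto intro: L)
  define G where "G y = integral {p..y} (\<lambda>s. \<bar>g s\<bar>)" for y
  have G_cont: "continuous_on {p..q} G"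
    unfolding G_def[abs_def] by (rule indefinite_integral_continuous_1[OF ag_int])
  have zW: "(\<lambda>s. z s * W s) integrable_on {p..q}"
    by (intro integrable_continuous_real continuous_intros z W)
  have split: "integral {p..y} h - integral {p..x} h = integral {x..y} h"
    if "h integrable_on {p..q}" "p \<le> x" "x \<le> y" "y \<le> q" for x y and h :: "real \<Rightarrow> real"
  proof -
    have "h integrable_on {p..y}"
      by (rule integrable_on_subinterval[OF that(1)]) (use that in auto)
    from Henstock_Kurzweil_Integration.integral_combine[OF that(2,3) this] show ?thesis by simp
  qed
  define F where "F y = integral {p..y} (\<lambda>s. g s * v s) + integral {p..y} (\<lambda>s. z s * W s) - v y * W y" for y
  have "F q = F p"
  proof (rule zero_derivative_criterion[OF G_cont _ pq])
    fix x y assume xy: "p \<le> x" "x \<le> y" "y \<le> q"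
    have sub: "{x..y} \<subseteq> {p..q}" using xy by auto
    let ?I = "integral {x..y}"
    have g': "g integrable_on {x..y}" and ag': "(\<lambda>s. \<bar>g s\<bar>) integrable_on {x..y}"
      and gv': "(\<lambda>s. g s * v s) integrable_on {x..y}" and zW': "(\<lambda>s. z s * W s) integrable_on {x..y}"
      and z': "z integrable_on {x..y}"
      using integrable_on_subinterval[OF _ sub] g_int ag_int gv zW integrable_continuous_real[OF z] by blast+
    have A: "G y - G x = ?I (\<lambda>s. \<bar>g s\<bar>)"
      unfolding G_def by (rule split[OF ag_int xy])
    have A0: "0 \<le> G y - G x"
      unfolding A by (rule Henstock_Kurzweil_Integration.integral_nonneg[OF ag']) simp
    have "F y - F x = ?I (\<lambda>s. g s * v s) + ?I (\<lambda>s. z s * W s) - (v x * ?I g + ?I z * W y)"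
      unfolding F_def v[OF xy, symmetric] Wg[OF xy, symmetric]
      using split[OF gv xy] split[OF zW xy] by (simp add: algebra_simps)
    also have "\<dots> = ?I (\<lambda>s. (g s * v s + z s * W s) - (v x * g s + z s * W y))"
      using g' gv' zW' z'
      by (simp add: Henstock_Kurzweil_Integration.integral_diff Henstock_Kurzweil_Integration.integral_add
          Henstock_Kurzweil_Integration.integrable_add integrable_on_mult_right integrable_on_mult_left)
    finally have F_eq: "F y - F x = ?I (\<lambda>s. (g s * v s + z s * W s) - (v x * g s + z s * W y))" .
    have "norm (F y - F x) \<le> ?I (\<lambda>s. (L * (y - x)) * \<bar>g s\<bar> + L * (G y - G x))"
      unfolding F_eq
    proof (rule integral_norm_bound_integral)
      show "(\<lambda>s. (g s * v s + z s * W s) - (v x * g s + z s * W y)) integrable_on {x..y}"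
        using g' gv' zW' z'
        by (intro Henstock_Kurzweil_Integration.integrable_diff Henstock_Kurzweil_Integration.integrable_add
            integrable_on_mult_right integrable_on_mult_left)
      show "(\<lambda>s. (L * (y - x)) * \<bar>g s\<bar> + L * (G y - G x)) integrable_on {x..y}"
        using ag' by (intro Henstock_Kurzweil_Integration.integrable_add integrable_on_mult_right
          integrable_const_ivl)
      fix s assume s: "s \<in> {x..y}"
      have "\<bar>v s - v x\<bar> \<le> L * (y - x)"
        using v_lip[of x s] s xy \<open>0 \<le> L\<close> by (auto intro: order_trans[OF _ mult_left_mono])
      moreover have "\<bar>W s - W y\<bar> \<le> G y - G x"
      proof -
        have "s \<le> y" "p \<le> s" "x \<le> s" using s xy by auto
        have "\<bar>W y - W s\<bar> \<le> integral {s..y} (\<lambda>s. \<bar>g s\<bar>)"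
          unfolding Wg[OF \<open>p \<le> s\<close> \<open>s \<le> y\<close> xy(3)] real_norm_def[symmetric]
        proof (rule integral_norm_bound_integral)
          show "g integrable_on {s..y}" "(\<lambda>s. norm (g s)) integrable_on {s..y}"
            using integrable_on_subinterval[OF g', of s y] integrable_on_subinterval[OF ag', of s y] s by auto
        qed simp
        also have "\<dots> \<le> ?I (\<lambda>s. \<bar>g s\<bar>)"
          using s integrable_on_subinterval[OF ag', of s y] ag'
          by (intro integral_subset_le) auto
        finally show ?thesis unfolding A by (simp add: abs_minus_commute)
      qed
      moreover have "\<bar>z s\<bar> \<le> L" using L s xy by auto
      ultimately have "\<bar>g s * (v s - v x)\<bar> + \<bar>z s * (W s - W y)\<bar> \<le> \<bar>g s\<bar> * (L * (y - x)) + L * (G y - G x)"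
        unfolding abs_mult by (intro add_mono mult_mono) (auto simp: \<open>0 \<le> L\<close>)
      moreover have "(g s * v s + z s * W s) - (v x * g s + z s * W y) = g s * (v s - v x) + z s * (W s - W y)"
        by (simp add: algebra_simps)
      ultimately show "norm ((g s * v s + z s * W s) - (v x * g s + z s * W y))
          \<le> (L * (y - x)) * \<bar>g s\<bar> + L * (G y - G x)"
        using abs_triangle_ineq[of "g s * (v s - v x)" "z s * (W s - W y)"]
        by (simp add: mult.commute)
    qed
    also have "\<dots> = (L * (y - x)) * (G y - G x) + L * (G y - G x) * (y - x)"
      using ag' xy unfolding A
      by (simp add: Henstock_Kurzweil_Integration.integral_add integrable_on_mult_right integrable_const_ivl)
    also have "\<dots> = (2 * L) * (y - x) * \<bar>G y - G x\<bar>"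
      using A0 by (simp add: algebra_simps)
    finally show "\<bar>F y - F x\<bar> \<le> (2 * L) * (y - x) * \<bar>G y - G x\<bar>" by simp
  qed
  then show ?thesis
    unfolding F_def by simp
qed

text \<open>
  Integration by parts on exhausting compact subintervals; the boundary terms vanish in the limit
  since \<open>W\<close>, having an integrable weak derivative, is bounded.
\<close>

lemma weak_integration_by_parts:
  assumes v: "continuous_on {0..1} v" "v 0 = 0" "v 1 = 0"
    and z: "z \<in> L2" "continuous_on {0<..<1} z" "weak_deriv 1 v z"
    and W: "W \<in> L2" "continuous_on {0<..<1} W" and g: "g \<in> L2" "weak_deriv 1 W g"
  shows "(LINT s|unit_lebesgue. v s * g s) = - (LINT s|unit_lebesgue. z s * W s)"
proof -
  have v': "continuous_on {0<..<1} v"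
    by (rule continuous_on_subset[OF v(1)]) auto
  have vL2: "v \<in> L2"
    by (rule L2_continuous[OF v(1)])
  have gv: "integrable unit_lebesgue (\<lambda>s. g s * v s)" and zW: "integrable unit_lebesgue (\<lambda>s. z s * W s)"
    by (intro L2_mult_integrable g z W vL2)+
  note z_int = L2_integrable[OF z(1)] and g_int = L2_integrable[OF g(1)]
  define C where "C = \<bar>W (1/2)\<bar> + (LINT s|unit_lebesgue. \<bar>g s\<bar>)"
  have W_bound: "\<bar>W y\<bar> \<le> C" if "0 < y" "y < 1" for y
  proof -
    have "\<bar>W y - W (1/2)\<bar> \<le> (LINT s|unit_lebesgue. \<bar>g s\<bar>)"
    proof (cases "1/2 \<le> y")
      case True
      show ?thesis
        by (rule weak_deriv_bounded[OF W(2) g_int g(2)]) (use True that in auto)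
    next
      case False
      have "\<bar>W (1/2) - W y\<bar> \<le> (LINT s|unit_lebesgue. \<bar>g s\<bar>)"
        by (rule weak_deriv_bounded[OF W(2) g_int g(2)]) (use False that in auto)
      then show ?thesis by (simp add: abs_minus_commute)
    qed
    then show ?thesis unfolding C_def by linarith
  qed
  have parts: "integral {unit_cut n..1 - unit_cut n} (\<lambda>s. g s * v s)
      = v (1 - unit_cut n) * W (1 - unit_cut n) - v (unit_cut n) * W (unit_cut n)
        - integral {unit_cut n..1 - unit_cut n} (\<lambda>s. z s * W s)" for n
  proof (rule integration_by_parts_indefinite)
    note b = unit_cut_bounds[of n]
    have S: "{unit_cut n..1 - unit_cut n} \<subseteq> {0<..<1}" "{unit_cut n..1 - unit_cut n} \<in> sets lebesgue"
      using b by auto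
    show "unit_cut n \<le> 1 - unit_cut n" using b by simp
    show "continuous_on {unit_cut n..1 - unit_cut n} z" "continuous_on {unit_cut n..1 - unit_cut n} W"
      using continuous_on_subset[OF _ S(1)] z W by blast+
    show "v y - v x = integral {x..y} z" "W y - W x = integral {x..y} g"
      if "unit_cut n \<le> x" "x \<le> y" "y \<le> 1 - unit_cut n" for x y
      using that b
      by (intro weak_deriv_integral[OF v' z_int z(3)] weak_deriv_integral[OF W(2) g_int g(2)]; simp)+
    show "g absolutely_integrable_on {unit_cut n..1 - unit_cut n}"
      using unit_integrable_subset(1)[OF g_int S] S(2)
      by (simp add: set_integrable_def integrable_restrict_space)
    show "(\<lambda>s. g s * v s) integrable_on {unit_cut n..1 - unit_cut n}"
      by (rule unit_integrable_subset(2)[OF gv S])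
  qed
  have v_lim: "(\<lambda>n. v (unit_cut n)) \<longlonglongrightarrow> 0" "(\<lambda>n. v (1 - unit_cut n)) \<longlonglongrightarrow> 0"
  proof -
    have cut_ivl: "unit_cut n \<in> {0..1}" "1 - unit_cut n \<in> {0..1}" for n
      using unit_cut_bounds[of n] by auto
    have "(\<lambda>n. v (unit_cut n)) \<longlonglongrightarrow> v 0"
      by (rule continuous_on_tendsto_compose[OF v(1) unit_cut_tendsto]) (use cut_ivl in auto)
    moreover have "(\<lambda>n. 1 - unit_cut n) \<longlonglongrightarrow> 1"
      using tendsto_diff[OF tendsto_const unit_cut_tendsto, of 1] by simp
    then have "(\<lambda>n. v (1 - unit_cut n)) \<longlonglongrightarrow> v 1"
      by (rule continuous_on_tendsto_compose[OF v(1)]) (use cut_ivl in auto)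
    ultimately show "(\<lambda>n. v (unit_cut n)) \<longlonglongrightarrow> 0" "(\<lambda>n. v (1 - unit_cut n)) \<longlonglongrightarrow> 0"
      using v by simp_all
  qed
  have boundary: "(\<lambda>n. v (r n) * W (r n)) \<longlonglongrightarrow> 0"
    if lim: "(\<lambda>n. v (r n)) \<longlonglongrightarrow> 0" and r: "\<And>n. 0 < r n \<and> r n < 1" for r :: "nat \<Rightarrow> real"
  proof (rule Lim_null_comparison)
    show "\<forall>\<^sub>F n in sequentially. norm (v (r n) * W (r n)) \<le> \<bar>v (r n)\<bar> * C"
      using W_bound r by (intro always_eventually allI) (simp add: abs_mult mult_left_mono)
    show "(\<lambda>n. \<bar>v (r n)\<bar> * C) \<longlonglongrightarrow> 0"
      using tendsto_mult[OF tendsto_rabs_zero[OF lim] tendsto_const, of C] by simp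
  qed
  have "(\<lambda>n. v (1 - unit_cut n) * W (1 - unit_cut n) - v (unit_cut n) * W (unit_cut n)
      - integral {unit_cut n..1 - unit_cut n} (\<lambda>s. z s * W s)) \<longlonglongrightarrow> 0 - 0 - (LINT s|unit_lebesgue. z s * W s)"
  proof (intro tendsto_diff boundary v_lim unit_integral_cut_tendsto zW)
    show "0 < unit_cut n \<and> unit_cut n < 1" "0 < 1 - unit_cut n \<and> 1 - unit_cut n < 1" for n
      using unit_cut_bounds[of n] by auto
  qed
  from LIMSEQ_unique[OF unit_integral_cut_tendsto[OF gv, unfolded parts] this]
  show ?thesis by (simp add: mult.commute)
qed

text \<open>
  Since the interval has length 1, every value of \<open>v\<close> is at most \<open>\<integral> \<bar>z\<bar> \<le> norm2 z\<close> away from the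
  boundary value 0.
\<close>

lemma Poincare_inequality:
  assumes v: "continuous_on {0..1} v" "v 0 = 0" and z: "z \<in> L2" "weak_deriv 1 v z"
  shows "norm2 v \<le> norm2 z"
proof -
  have v': "continuous_on {0<..<1} v"
    by (rule continuous_on_subset[OF v(1)]) auto
  have vL2: "v \<in> L2"
    by (rule L2_continuous[OF v(1)])
  have az: "(\<lambda>s. \<bar>z s\<bar>) \<in> L2"
    using z(1) by (auto simp: L2_def)
  have "(LINT s|unit_lebesgue. \<bar>z s\<bar>) \<le> norm2 z"
  proof -
    have "norm2 (\<lambda>s. 1) = 1"
      by (simp only: norm2_def abs_one power_one integral_unit_const real_sqrt_one)
    moreover have "norm2 (\<lambda>s. \<bar>z s\<bar>) = norm2 z"
      by (simp add: norm2_def)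
    ultimately show ?thesis
      using L2_Cauchy_Schwarz[OF az L2_const[of 1]] by simp
  qed
  then have step: "\<bar>v y - v x\<bar> \<le> norm2 z" if "0 < x" "x \<le> y" "y < 1" for x y
    using weak_deriv_bounded[OF v' L2_integrable[OF z(1)] z(2) that] by simp
  have bound: "\<bar>v y\<bar> \<le> norm2 z" if y: "0 < y" "y < 1" for y
  proof -
    have "(v \<longlongrightarrow> v 0) (at_right 0)"
      by (rule continuous_on_Icc_at_rightD[OF v(1)]) simp
    then have "((\<lambda>x. \<bar>v y - v x\<bar>) \<longlongrightarrow> \<bar>v y - v 0\<bar>) (at_right 0)"
      by (intro tendsto_intros)
    moreover have "\<forall>\<^sub>F x in at_right 0. \<bar>v y - v x\<bar> \<le> norm2 z"
      using eventually_at_right_real[OF y(1)]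
      by eventually_elim (intro step; use y in simp)
    ultimately have "\<bar>v y - v 0\<bar> \<le> norm2 z"
      by (rule tendsto_upperbound) simp
    then show ?thesis using v by simp
  qed
  have "(norm2 v)\<^sup>2 \<le> (LINT s|unit_lebesgue. (norm2 z)\<^sup>2)"
    unfolding norm2_sq[of v]
  proof (rule Bochner_Integration.integral_mono)
    show "(v s)\<^sup>2 \<le> (norm2 z)\<^sup>2" if "s \<in> space unit_lebesgue" for s
      using power_mono[OF bound, of s 2] that by simp
  qed (use vL2 L2_integrable_square in auto)
  then have "(norm2 v)\<^sup>2 \<le> (norm2 z)\<^sup>2"
    by (simp only: integral_unit_const)
  then show ?thesis
    by (rule power2_le_imp_le) (rule norm2_nonneg)
qed

section \<open>Test functions and the heat flux\<close>

lemma test_function_has_derivative: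
  assumes "test_function \<phi>"
  shows "(\<phi> has_real_derivative deriv \<phi> x) (at x)"
proof -
  have "(deriv ^^ 0) \<phi> differentiable_on UNIV"
    using assms unfolding test_function_def by blast
  then show ?thesis
    by (simp add: differentiable_on_def DERIV_deriv_iff_real_differentiable)
qed

text \<open>
  The interval is open so that \<open>\<phi>\<close> vanishes at \<open>r\<close> and \<open>s\<close> and no boundary terms arise in integrations
  by parts over \<open>[r, s]\<close>.
\<close>

lemma test_function_support:
  assumes "test_function \<phi>"
  obtains r s where "0 < r" "r \<le> s" "s < 1" "\<And>x. x \<notin> {r<..<s} \<Longrightarrow> \<phi> x = 0"
    "\<And>x. x \<notin> {r..s} \<Longrightarrow> deriv \<phi> x = 0"
proof -
  obtain K where K: "compact K" "K \<subseteq> {0<..<1}" "\<And>x. x \<notin> K \<Longrightarrow> \<phi> x = 0"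
    using assms unfolding test_function_def by blast
  obtain r s where rs: "0 < r" "r \<le> s" "s < 1" "K \<subseteq> {r<..<s}"
  proof (cases "K = {}")
    case True
    then show ?thesis by (intro that[of "1/2" "1/2"]) auto
  next
    case False
    obtain l where l: "l \<in> K" "\<And>x. x \<in> K \<Longrightarrow> l \<le> x"
      using compact_attains_inf[OF K(1) False] by blast
    obtain u where u: "u \<in> K" "\<And>x. x \<in> K \<Longrightarrow> x \<le> u"
      using compact_attains_sup[OF K(1) False] by blast
    have lu: "0 < l" "l \<le> u" "u < 1" using l u K(2) by auto
    show ?thesis
    proof (rule that[of "l / 2" "(u + 1) / 2"])
      show "K \<subseteq> {l / 2<..<(u + 1) / 2}"
      proof
        fix x assume "x \<in> K"
        then have "l \<le> x" "x \<le> u" using l u by auto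
        then show "x \<in> {l / 2<..<(u + 1) / 2}" using lu by auto
      qed
    qed (use lu in auto)
  qed
  have zero: "\<phi> x = 0" if "x \<notin> {r<..<s}" for x
    using K(3) rs(4) that by blast
  have "deriv \<phi> x = 0" if x: "x \<notin> {r..s}" for x
  proof (rule DERIV_imp_deriv)
    have "open (- {r..s})" by (simp add: open_Compl)
    then show "(\<phi> has_real_derivative 0) (at x)"
      by (rule has_field_derivative_transform_within_open[OF DERIV_const[of 0]]) (use x zero in auto)
  qed
  with rs zero show ?thesis by (intro that) auto
qed

lemma test_function_deriv:
  assumes "test_function \<phi>"
  shows "test_function (deriv \<phi>)"
proof -
  obtain r s where rs: "0 < r" "s < 1" "\<And>x. x \<notin> {r..s} \<Longrightarrow> deriv \<phi> x = 0"
    using test_function_support[OF assms] by metis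
  have "(deriv ^^ n) (deriv \<phi>) differentiable_on UNIV" for n
    using assms unfolding test_function_def by (metis comp_apply funpow_Suc_right)
  moreover have "compact {r..s}" "{r..s} \<subseteq> {0<..<1}" using rs by auto
  ultimately show ?thesis
    unfolding test_function_def using rs(3) by blast
qed

lemma test_function_continuous: "test_function \<phi> \<Longrightarrow> continuous_on A \<phi>"
  using test_function_has_derivative DERIV_isCont continuous_at_imp_continuous_on by blast

lemma classical_weak_derivative:
  assumes p: "continuous_on {0<..<1} p" and p': "continuous_on {0<..<1} p'"
    and deriv: "\<And>x. 0 < x \<Longrightarrow> x < 1 \<Longrightarrow> (p has_real_derivative p' x) (at x)"
    and \<phi>: "test_function \<phi>"
  shows "integrable unit_lebesgue (\<lambda>x. p' x * \<phi> x)"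
    and "(LINT x|unit_lebesgue. p x * deriv \<phi> x) = - (LINT x|unit_lebesgue. p' x * \<phi> x)"
proof -
  obtain r s where rs: "0 < r" "r \<le> s" "s < 1" "\<And>x. x \<notin> {r<..<s} \<Longrightarrow> \<phi> x = 0"
    "\<And>x. x \<notin> {r..s} \<Longrightarrow> deriv \<phi> x = 0"
    by (rule test_function_support[OF \<phi>]) (rule that)
  have sub: "{r..s} \<subseteq> {0<..<1}" using rs by auto
  note cont = continuous_on_subset[OF p sub] continuous_on_subset[OF p' sub]
    test_function_continuous[OF \<phi>] test_function_continuous[OF test_function_deriv[OF \<phi>]]
  have c1: "continuous_on {r..s} (\<lambda>x. p' x * \<phi> x)" and c2: "continuous_on {r..s} (\<lambda>x. p x * deriv \<phi> x)"
    by (intro continuous_on_mult cont)+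
  have out: "p' x * \<phi> x = 0" "p x * deriv \<phi> x = 0" if "x \<notin> {r..s}" for x
    using rs(4)[of x] rs(5)[of x] that by auto
  have L1: "integrable unit_lebesgue (\<lambda>x. p' x * \<phi> x)"
    "(LINT x|unit_lebesgue. p' x * \<phi> x) = integral {r..s} (\<lambda>x. p' x * \<phi> x)"
    by (rule LINT_eq_integral_subinterval[OF rs(1,3) c1]; use out(1) in blast)+
  have L2: "(LINT x|unit_lebesgue. p x * deriv \<phi> x) = integral {r..s} (\<lambda>x. p x * deriv \<phi> x)"
    by (rule LINT_eq_integral_subinterval[OF rs(1,3) c2]; use out(2) in blast)
  show "integrable unit_lebesgue (\<lambda>x. p' x * \<phi> x)"
    by (rule L1(1))
  have "((\<lambda>x. p' x * \<phi> x + p x * deriv \<phi> x) has_integral p s * \<phi> s - p r * \<phi> r) {r..s}"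
  proof (rule fundamental_theorem_of_calculus[OF rs(2)])
    fix x assume x: "x \<in> {r..s}"
    have "((\<lambda>x. p x * \<phi> x) has_real_derivative p' x * \<phi> x + deriv \<phi> x * p x) (at x)"
      using x rs by (intro DERIV_mult deriv test_function_has_derivative \<phi>) auto
    then show "((\<lambda>x. p x * \<phi> x) has_vector_derivative p' x * \<phi> x + p x * deriv \<phi> x) (at x within {r..s})"
      by (simp add: has_real_derivative_iff_has_vector_derivative[symmetric] mult.commute
          has_field_derivative_at_within)
  qed
  then have "integral {r..s} (\<lambda>x. p' x * \<phi> x + p x * deriv \<phi> x) = 0"
    using rs(4)[of r] rs(4)[of s] by (simp add: integral_unique)
  then have "integral {r..s} (\<lambda>x. p' x * \<phi> x) + integral {r..s} (\<lambda>x. p x * deriv \<phi> x) = 0"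
    using c1 c2 by (simp add: Henstock_Kurzweil_Integration.integral_add integrable_continuous_real)
  then show "(LINT x|unit_lebesgue. p x * deriv \<phi> x) = - (LINT x|unit_lebesgue. p' x * \<phi> x)"
    unfolding L1(2) L2 by simp
qed

text \<open>
  The heat equation in divergence form: with \<open>v = \<theta>\<close>, \<open>z = \<theta>\<^sub>x\<close>, \<open>w = \<theta>\<^sub>x\<^sub>x\<close>, \<open>p = u\<^sub>t\<close> and \<open>g = \<theta>\<^sub>t\<close> the flux
  \<open>k \<theta>\<^sub>x - \<lambda> u\<^sub>t\<close> has the weak derivative \<open>\<theta>\<^sub>t\<close>. The function \<open>w\<close> is the weak derivative of \<open>z\<close> because the
  derivative of a test function is a test function again. The function
  \<open>u\<^sub>x\<^sub>t\<close> is tested on compact subintervals only, where it is continuous.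
\<close>

lemma flux_weak_derivative:
  assumes weak1: "weak_deriv 1 v z" and weak2: "weak_deriv 2 v w" and L2: "z \<in> L2" "w \<in> L2"
    and p: "continuous_on {0..1} p" "continuous_on {0<..<1} p'"
      "\<And>x. 0 < x \<Longrightarrow> x < 1 \<Longrightarrow> (p has_real_derivative p' x) (at x)"
    and g: "g \<in> L2" "AE x in unit_lebesgue. g x = k * w x - lam * p' x"
  shows "weak_deriv 1 (\<lambda>x. k * z x - lam * p x) g"
  unfolding weak_deriv_def
proof (intro allI impI)
  fix \<phi> assume \<phi>: "test_function \<phi>"
  note \<phi>' = test_function_deriv[OF \<phi>]
  have \<phi>L2: "\<phi> \<in> L2" "deriv \<phi> \<in> L2"
    by (intro L2_continuous test_function_continuous \<phi> \<phi>')+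
  have p_open: "continuous_on {0<..<1} p"
    by (rule continuous_on_subset[OF p(1)]) auto
  note classical = classical_weak_derivative[OF p_open p(2,3) \<phi>]
  have z: "(LINT x|unit_lebesgue. z x * deriv \<phi> x) = - (LINT x|unit_lebesgue. w x * \<phi> x)"
  proof -
    have "(LINT x|unit_lebesgue. v x * deriv (deriv \<phi>) x) = - (LINT x|unit_lebesgue. z x * deriv \<phi> x)"
      using weak1 \<phi>' by (simp add: weak_deriv_def)
    moreover have "(LINT x|unit_lebesgue. v x * deriv (deriv \<phi>) x) = (LINT x|unit_lebesgue. w x * \<phi> x)"
      using weak2 \<phi> by (simp add: weak_deriv_def numeral_2_eq_2)
    ultimately show ?thesis by simp
  qed
  have zi: "integrable unit_lebesgue (\<lambda>x. z x * deriv \<phi> x)" and wi: "integrable unit_lebesgue (\<lambda>x. w x * \<phi> x)"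
    and pi: "integrable unit_lebesgue (\<lambda>x. p x * deriv \<phi> x)" and gi: "integrable unit_lebesgue (\<lambda>x. g x * \<phi> x)"
    by (intro L2_mult_integrable L2 \<phi>L2 L2_continuous p g)+
  have "(LINT x|unit_lebesgue. (k * z x - lam * p x) * deriv \<phi> x)
      = (LINT x|unit_lebesgue. k * (z x * deriv \<phi> x) - lam * (p x * deriv \<phi> x))"
    by (simp add: algebra_simps)
  also have "\<dots> = - (k * (LINT x|unit_lebesgue. w x * \<phi> x) - lam * (LINT x|unit_lebesgue. p' x * \<phi> x))"
    using zi pi by (simp add: z classical(2))
  also have "k * (LINT x|unit_lebesgue. w x * \<phi> x) - lam * (LINT x|unit_lebesgue. p' x * \<phi> x)
      = (LINT x|unit_lebesgue. k * (w x * \<phi> x) - lam * (p' x * \<phi> x))"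
    using wi classical(1) by simp
  also have "\<dots> = (LINT x|unit_lebesgue. g x * \<phi> x)"
  proof (rule integral_cong_AE)
    show "AE x in unit_lebesgue. k * (w x * \<phi> x) - lam * (p' x * \<phi> x) = g x * \<phi> x"
      using g(2) by eventually_elim (simp add: left_diff_distrib mult.assoc)
    show "(\<lambda>x. k * (w x * \<phi> x) - lam * (p' x * \<phi> x)) \<in> borel_measurable unit_lebesgue"
      using borel_measurable_integrable[OF wi] borel_measurable_integrable[OF classical(1)] by measurable
    show "(\<lambda>x. g x * \<phi> x) \<in> borel_measurable unit_lebesgue"
      using gi by simp
  qed
  finally show "(LINT x|unit_lebesgue. (k * z x - lam * p x) * (deriv ^^ 1) \<phi> x)
      = (-1) ^ 1 * (LINT x|unit_lebesgue. g x * \<phi> x)"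
    by simp
qed

section \<open>Partial derivatives on the strip\<close>

lemma continuous_on_time_slice:
  assumes "continuous_on (S \<times> X) w" "t \<in> S"
  shows "continuous_on X (\<lambda>x. w (t, x))"
  by (rule continuous_on_compose2[OF assms(1)]) (use assms(2) in \<open>auto intro!: continuous_intros\<close>)

text \<open>
  Writing increments of \<open>w\<close> in \<open>x\<close> as \<open>\<integral> w\<^sub>x dx\<close> and differentiating under the integral sign in \<open>t\<close>
  shows that \<open>w\<^sub>t\<close> is an indefinite integral of the \<open>t\<close>-derivative \<open>wxt\<close> of \<open>w\<^sub>x\<close>.
\<close>

lemma mixed_partials_equal:
  assumes wt: "\<And>t x. 0 < t \<Longrightarrow> 0 < x \<Longrightarrow> x < 1 \<Longrightarrow> ((\<lambda>s. w (s, x)) has_real_derivative wt (t, x)) (at t)"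
    and wx: "\<And>t x. 0 < t \<Longrightarrow> 0 < x \<Longrightarrow> x < 1 \<Longrightarrow> ((\<lambda>y. w (t, y)) has_real_derivative wx (t, x)) (at x)"
    and wxt: "\<And>t x. 0 < t \<Longrightarrow> 0 < x \<Longrightarrow> x < 1 \<Longrightarrow> ((\<lambda>s. wx (s, x)) has_real_derivative wxt (t, x)) (at t)"
    and wtx: "\<And>t x. 0 < t \<Longrightarrow> 0 < x \<Longrightarrow> x < 1 \<Longrightarrow> ((\<lambda>y. wt (t, y)) has_real_derivative wtx (t, x)) (at x)"
    and cont: "continuous_on open_strip wx" "continuous_on open_strip wxt"
    and tx: "0 < t" "0 < x" "x < 1"
  shows "wtx (t, x) = wxt (t, x)"
proof -
  define p q where "p = x / 2" and "q = (x + 1) / 2"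
  have pq: "0 < p" "p < x" "x < q" "q < 1" using tx by (auto simp: p_def q_def)
  have sub: "{p..y} \<subseteq> {0<..<1}" if "y \<le> q" for y using pq that by auto
  have wt_eq: "wt (t, y) - wt (t, p) = integral {p..y} (\<lambda>r. wxt (t, r))" if y: "p \<le> y" "y \<le> q" for y
  proof (rule DERIV_unique)
    have "((\<lambda>s. integral (cbox p y) (\<lambda>r. wx (s, r))) has_field_derivative
        integral (cbox p y) (\<lambda>r. wxt (t, r))) (at t within {0<..})"
    proof (rule leibniz_rule_field_derivative)
      show "((\<lambda>s. wx (s, r)) has_real_derivative wxt (s, r)) (at s within {0<..})"
        if "s \<in> {0<..}" "r \<in> cbox p y" for s r
      proof -
        have "r \<in> {0<..<1}" using that(2) sub[OF y(2)] by auto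
        then show ?thesis
          using that(1) by (intro has_field_derivative_at_within[OF wxt]) auto
      qed
      show "(\<lambda>r. wx (s, r)) integrable_on cbox p y" if "s \<in> {0<..}" for s
        using continuous_on_subset[OF continuous_on_time_slice[OF cont(1) that] sub[OF y(2)]]
        by (simp add: integrable_continuous_real)
      have "continuous_on ({0<..} \<times> cbox p y) wxt"
        by (rule continuous_on_subset[OF cont(2)]) (use sub[OF y(2)] in auto)
      then show "continuous_on ({0<..} \<times> cbox p y) (\<lambda>(s, r). wxt (s, r))"
        by simp
    qed (use tx in auto)
    then have D: "((\<lambda>s. integral {p..y} (\<lambda>r. wx (s, r))) has_real_derivative
        integral {p..y} (\<lambda>r. wxt (t, r))) (at t)"
      using tx by (simp add: at_within_open[of t "{0<..}"])
    show "((\<lambda>s. w (s, y) - w (s, p)) has_real_derivative integral {p..y} (\<lambda>r. wxt (t, r))) (at t)"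
    proof (rule has_field_derivative_transform_within_open[OF D, of "{0<..}"])
      fix s :: real assume s: "s \<in> {0<..}"
      have "((\<lambda>r. wx (s, r)) has_integral w (s, y) - w (s, p)) {p..y}"
      proof (rule fundamental_theorem_of_calculus[OF y(1)])
        fix r assume "r \<in> {p..y}"
        then have "0 < r" "r < 1" using y pq by auto
        from wx[OF _ this, of s] s
        show "((\<lambda>r. w (s, r)) has_vector_derivative wx (s, r)) (at r within {p..y})"
          by (simp add: has_real_derivative_iff_has_vector_derivative[symmetric]
              has_field_derivative_at_within)
      qed
      then show "integral {p..y} (\<lambda>r. wx (s, r)) = w (s, y) - w (s, p)"
        by (rule integral_unique)
    qed (use tx in auto)
    show "((\<lambda>s. w (s, y) - w (s, p)) has_real_derivative wt (t, y) - wt (t, p)) (at t)"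
      using y pq tx by (intro DERIV_diff wt) auto
  qed
  have "((\<lambda>y. integral {p..y} (\<lambda>r. wxt (t, r))) has_real_derivative wxt (t, x)) (at x within {p..q})"
  proof (rule integral_has_real_derivative)
    show "continuous_on {p..q} (\<lambda>r. wxt (t, r))"
      by (rule continuous_on_subset[OF continuous_on_time_slice[OF cont(2)] sub]) (use tx in auto)
  qed (use pq in auto)
  from DERIV_add[OF DERIV_const[of "wt (t, p)"] this]
  have D: "((\<lambda>y. wt (t, p) + integral {p..y} (\<lambda>r. wxt (t, r))) has_real_derivative wxt (t, x)) (at x within {p..q})"
    by simp
  have "((\<lambda>y. wt (t, y)) has_real_derivative wxt (t, x)) (at x within {p..q})"
    by (rule has_field_derivative_transform_within[OF D zero_less_one]) (use pq wt_eq[symmetric] in auto)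
  then have "((\<lambda>y. wt (t, y)) has_real_derivative wxt (t, x)) (at x)"
    using pq by (simp add: at_within_interior[of x "{p..q}"] interior_atLeastAtMost_real)
  then show ?thesis
    by (rule DERIV_unique[OF wtx[OF tx]])
qed

text \<open>
  A nonzero value of \<open>w\<^sub>t\<close> at the boundary point \<open>(t, 0)\<close> would persist near that point, and the
  increment of \<open>w\<close> over a short time interval would stay away from 0 as \<open>x \<rightarrow> 0\<close>.
\<close>

lemma time_derivative_zero_on_boundary:
  assumes w: "continuous_on closed_strip w" and zero: "\<And>t. 0 < t \<Longrightarrow> w (t, 0) = 0"
    and wt: "\<And>t x. 0 < t \<Longrightarrow> 0 < x \<Longrightarrow> x < 1 \<Longrightarrow> ((\<lambda>s. w (s, x)) has_real_derivative wt (t, x)) (at t)"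
    and cont: "continuous_on closed_strip wt" and t: "0 < t"
  shows "wt (t, 0) = 0"
proof (rule ccontr)
  assume nz: "wt (t, 0) \<noteq> 0"
  define e where "e = \<bar>wt (t, 0)\<bar> / 2"
  have "0 < e" using nz by (simp add: e_def)
  moreover have "(t, 0) \<in> closed_strip" using t by auto
  ultimately obtain \<delta> where \<delta>: "0 < \<delta>"
    "\<And>p. p \<in> closed_strip \<Longrightarrow> dist p (t, 0) < \<delta> \<Longrightarrow> dist (wt p) (wt (t, 0)) < e"
    using cont unfolding continuous_on_iff by meson
  define h where "h = \<delta> / 2"
  have h: "0 < h" using \<delta>(1) by (simp add: h_def)
  have incr: "h * e \<le> \<bar>w (t + h, x) - w (t, x)\<bar>" if x: "0 < x" "x < min h 1" for x
  proof -
    obtain s where s: "t < s" "s < t + h" "w (t + h, x) - w (t, x) = (t + h - t) * wt (s, x)"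
      using MVT2[of t "t + h" "\<lambda>s. w (s, x)" "\<lambda>s. wt (s, x)"] wt t x h by auto
    have "dist (s, x) (t, 0) \<le> \<bar>s - t\<bar> + \<bar>x\<bar>"
      unfolding dist_Pair_Pair dist_real_def using sqrt_sum_squares_le_sum_abs[of "s - t" x] by simp
    also have "\<dots> < \<delta>" using s x by (simp add: h_def)
    finally have "dist (wt (s, x)) (wt (t, 0)) < e"
      using s t x by (intro \<delta>(2)) auto
    then have "e \<le> \<bar>wt (s, x)\<bar>"
      unfolding e_def dist_real_def by linarith
    then show ?thesis
      using s(3) h by (simp add: abs_mult)
  qed
  have lim: "((\<lambda>x. w (s, x)) \<longlongrightarrow> 0) (at_right 0)" if "0 < s" for s
  proof -
    have "continuous_on {0..1} (\<lambda>x. w (s, x))"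
      by (rule continuous_on_time_slice[OF w]) (use that in auto)
    from continuous_on_Icc_at_rightD[OF this] show ?thesis
      using zero[OF that] by simp
  qed
  have "((\<lambda>x. \<bar>w (t + h, x) - w (t, x)\<bar>) \<longlongrightarrow> \<bar>0 - 0\<bar>) (at_right 0)"
    using t h by (intro tendsto_intros lim) auto
  moreover have "\<forall>\<^sub>F x in at_right 0. h * e \<le> \<bar>w (t + h, x) - w (t, x)\<bar>"
    using eventually_at_right_real[of 0 "min h 1"] h
    by (auto elim!: eventually_mono intro: incr)
  ultimately have "h * e \<le> \<bar>0 - 0\<bar>"
    by (rule tendsto_lowerbound) simp
  then show False using h \<open>0 < e\<close> by (simp add: mult_le_0_iff)
qed

section \<open>The Lyapunov functional\<close>

lemma Young_weighted:
  fixes p q x r :: real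
  assumes "0 < r" "0 \<le> x" "x \<le> 1"
  shows "\<bar>x * p * q\<bar> \<le> r * p\<^sup>2 + q\<^sup>2 / (4 * r)"
proof -
  have "\<bar>x * p * q\<bar> \<le> 1 * (\<bar>p\<bar> * \<bar>q\<bar>)"
    using assms unfolding abs_mult mult.assoc by (intro mult_right_mono) auto
  also have "\<dots> \<le> r * p\<^sup>2 + q\<^sup>2 / (4 * r)"
  proof -
    have "0 \<le> (2 * r * \<bar>p\<bar> - \<bar>q\<bar>)\<^sup>2" by simp
    also have "\<dots> = 4 * r * (r * \<bar>p\<bar>\<^sup>2) + \<bar>q\<bar>\<^sup>2 - 4 * r * (\<bar>p\<bar> * \<bar>q\<bar>)"
      by (simp only: power2_eq_square) (simp add: algebra_simps)
    finally have "\<bar>p\<bar> * \<bar>q\<bar> \<le> (4 * r * (r * p\<^sup>2) + q\<^sup>2) / (4 * r)"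
      using assms(1) by (simp add: pos_le_divide_eq mult.commute)
    also have "\<dots> = r * p\<^sup>2 + q\<^sup>2 / (4 * r)"
      using assms(1) by (simp add: add_divide_distrib)
    finally show ?thesis by simp
  qed
  finally show ?thesis .
qed

text \<open>
  The weight \<open>\<epsilon>\<close> of the multiplier term \<open>\<integral> x u\<^sub>x u\<^sub>t\<close>: it must be small enough for the functional to stay
  equivalent to the energy, and for the terms it produces to be absorbed by the boundary damping,
  the viscous damping and the heat dissipation.
\<close>

locale lyapunov_weight =
  fixes a c \<mu> b k lam \<epsilon> :: real
  assumes pos: "0 < a" "0 < c" "0 \<le> \<mu>" "0 < b" "0 < k" "0 < lam" "0 < \<epsilon>"
    and equivalent: "2 * \<epsilon> \<le> c"
    and boundary_kinetic: "2 * \<epsilon> \<le> a * c\<^sup>2"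
    and boundary_potential: "4 * a * \<epsilon> \<le> 1"
    and viscous: "2 * \<epsilon> * \<mu> \<le> c\<^sup>2"
    and thermal: "4 * \<epsilon> * b * lam \<le> k * c\<^sup>2"
begin

text \<open>
  Constants of the differential inequality \<open>V' \<le> - rate V + gain_f \<parallel>f\<parallel>\<^sup>2 + gain_d d\<^sup>2\<close>. The factor
  \<open>\<epsilon> / 6\<close> compares the mechanical loss, at least \<open>\<epsilon> / 8 (p\<^sup>2 + c\<^sup>2 q\<^sup>2)\<close>, with the density, at most
  \<open>3 / 4 (p\<^sup>2 + c\<^sup>2 q\<^sup>2)\<close>.
\<close>

definition rate :: real where "rate = min (\<epsilon> / 6) k"
definition gain_f :: real where "gain_f = 1 / \<epsilon> + 2 * \<epsilon> / c\<^sup>2"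
definition gain_d :: real where "gain_d = c\<^sup>2 / (2 * a) + \<epsilon> * c\<^sup>2"

lemma rate_pos: "0 < rate" and gain_f_pos: "0 < gain_f" and gain_d_pos: "0 < gain_d"
  using pos by (auto simp: rate_def gain_f_def gain_d_def add_pos_pos)

text \<open>Mechanical energy density with the multiplier term; \<open>p\<close>, \<open>q\<close> stand for \<open>u\<^sub>t\<close>, \<open>u\<^sub>x\<close> at \<open>x\<close>.\<close>

definition lyap_density :: "real \<Rightarrow> real \<Rightarrow> real \<Rightarrow> real" where
  "lyap_density x p q = p\<^sup>2 / 2 + c\<^sup>2 * q\<^sup>2 / 2 + \<epsilon> * (x * p * q)"

text \<open>The part of the time derivative of the density that is an \<open>x\<close>-derivative.\<close>

definition lyap_flux :: "real \<Rightarrow> real \<Rightarrow> real \<Rightarrow> real" where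
  "lyap_flux x p q = c\<^sup>2 * (q * p) + \<epsilon> * (x * (p\<^sup>2 / 2 + c\<^sup>2 * q\<^sup>2 / 2))"

text \<open>
  What is left of the time derivative of the density after the flux is split off and the wave
  equation is used; \<open>z\<close> and \<open>h\<close> stand for \<open>\<theta>\<^sub>x\<close> and \<open>f\<close>.
\<close>

definition lyap_source :: "real \<Rightarrow> real \<Rightarrow> real \<Rightarrow> real \<Rightarrow> real \<Rightarrow> real" where
  "lyap_source x p q z h = - \<epsilon> / 2 * (p\<^sup>2 + c\<^sup>2 * q\<^sup>2) + (p + \<epsilon> * x * q) * (h - \<mu> * p - b * z)"

lemma density_bounds:
  assumes "0 \<le> x" "x \<le> 1"
  shows "(p\<^sup>2 + c\<^sup>2 * q\<^sup>2) / 4 \<le> lyap_density x p q" "lyap_density x p q \<le> 3 * (p\<^sup>2 + c\<^sup>2 * q\<^sup>2) / 4"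
proof -
  have "\<epsilon> * \<bar>x * p * q\<bar> \<le> \<epsilon> * (1 / (2 * c) * p\<^sup>2 + q\<^sup>2 / (4 * (1 / (2 * c))))"
    using pos assms by (intro mult_left_mono Young_weighted) auto
  also have "\<dots> = \<epsilon> / (2 * c) * (p\<^sup>2 + c\<^sup>2 * q\<^sup>2)"
    using pos by (simp add: field_simps power2_eq_square)
  also have "\<dots> \<le> 1 / 4 * (p\<^sup>2 + c\<^sup>2 * q\<^sup>2)"
    using pos equivalent by (intro mult_right_mono) (auto simp: field_simps)
  finally have "\<bar>\<epsilon> * (x * p * q)\<bar> \<le> 1 / 4 * (p\<^sup>2 + c\<^sup>2 * q\<^sup>2)"
    using pos by (simp add: abs_mult)
  then show "(p\<^sup>2 + c\<^sup>2 * q\<^sup>2) / 4 \<le> lyap_density x p q" "lyap_density x p q \<le> 3 * (p\<^sup>2 + c\<^sup>2 * q\<^sup>2) / 4"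
    unfolding lyap_density_def abs_le_iff by (auto simp: field_simps)
qed

lemma density_decay:
  assumes "0 \<le> x" "x \<le> 1"
  shows "- \<epsilon> / 4 * p\<^sup>2 - \<epsilon> * c\<^sup>2 / 8 * q\<^sup>2 \<le> - rate * lyap_density x p q"
proof -
  have "rate * lyap_density x p q \<le> \<epsilon> / 6 * (3 * (p\<^sup>2 + c\<^sup>2 * q\<^sup>2) / 4)"
    using density_bounds[OF assms, of p q] pos rate_pos
    by (intro mult_mono) (auto simp: rate_def intro: order_trans[rotated])
  also have "\<dots> = \<epsilon> / 8 * p\<^sup>2 + \<epsilon> * c\<^sup>2 / 8 * q\<^sup>2"
    by (simp add: field_simps)
  also have "\<dots> \<le> \<epsilon> / 4 * p\<^sup>2 + \<epsilon> * c\<^sup>2 / 8 * q\<^sup>2"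
    using pos by (simp add: mult_right_mono)
  finally show ?thesis by simp
qed

text \<open>
  The added bracket is the thermal contribution at \<open>x\<close>; its term \<open>b z p\<close> cancels the coupling term
  in the source. The viscous, thermal and force terms carrying \<open>\<epsilon> x q\<close> each cost \<open>\<epsilon> c\<^sup>2 / 8 q\<^sup>2\<close>, which
  leaves a quarter of the gain \<open>\<epsilon> c\<^sup>2 / 2 q\<^sup>2\<close>.
\<close>

lemma source_bound:
  assumes x: "0 \<le> x" "x \<le> 1"
  shows "lyap_source x p q z h + (b * (z * p) - b * k / lam * z\<^sup>2)
    \<le> - \<epsilon> / 4 * p\<^sup>2 - \<epsilon> * c\<^sup>2 / 8 * q\<^sup>2 - b * k / (2 * lam) * z\<^sup>2 + gain_f * h\<^sup>2"
proof -
  define r where "r = 2 / c\<^sup>2"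
  have r: "0 < r" "1 / (4 * r) = c\<^sup>2 / 8" using pos by (auto simp: r_def)
  have Y: "\<epsilon> * (s * \<bar>x * v * q\<bar>) \<le> \<epsilon> * (c\<^sup>2 / 8 * q\<^sup>2 + r * (s * v)\<^sup>2)" if "0 \<le> s" for s v
  proof -
    have "s * \<bar>x * v * q\<bar> = \<bar>x * (s * v) * q\<bar>"
      using that by (simp add: abs_mult)
    also have "\<dots> \<le> r * (s * v)\<^sup>2 + q\<^sup>2 / (4 * r)"
      by (rule Young_weighted[OF r(1) x])
    also have "q\<^sup>2 / (4 * r) = c\<^sup>2 / 8 * q\<^sup>2"
      using r(2) by (metis mult.commute mult_1_right times_divide_eq_right)
    finally show ?thesis using pos by (simp add: add.commute)
  qed
  have viscous_term: "- \<mu> * p\<^sup>2 - \<epsilon> * (\<mu> * (x * p * q)) \<le> \<epsilon> * c\<^sup>2 / 8 * q\<^sup>2"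
  proof -
    have "\<epsilon> * (r * (\<mu> * p)\<^sup>2) = (2 * \<epsilon> * \<mu> / c\<^sup>2) * (\<mu> * p\<^sup>2)"
      using pos by (simp add: r_def power_mult_distrib power2_eq_square)
    also have "\<dots> \<le> 1 * (\<mu> * p\<^sup>2)"
      using viscous pos by (intro mult_right_mono) auto
    finally have "\<epsilon> * (\<mu> * \<bar>x * p * q\<bar>) \<le> \<epsilon> * c\<^sup>2 / 8 * q\<^sup>2 + \<mu> * p\<^sup>2"
      using Y[of \<mu> p] pos by (simp add: distrib_left)
    moreover have "\<epsilon> * (\<mu> * - (x * p * q)) \<le> \<epsilon> * (\<mu> * \<bar>x * p * q\<bar>)"
      using pos by (intro mult_left_mono) auto
    ultimately show ?thesis by simp
  qed
  have thermal_term: "- \<epsilon> * (b * (x * z * q)) \<le> \<epsilon> * c\<^sup>2 / 8 * q\<^sup>2 + b * k / (2 * lam) * z\<^sup>2"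
  proof -
    have "\<epsilon> * (r * (b * z)\<^sup>2) = (2 * \<epsilon> * b / c\<^sup>2) * (b * z\<^sup>2)"
      using pos by (simp add: r_def power_mult_distrib power2_eq_square)
    also have "\<dots> \<le> (k / (2 * lam)) * (b * z\<^sup>2)"
      using thermal pos by (intro mult_right_mono) (auto simp: field_simps)
    also have "\<dots> = b * k / (2 * lam) * z\<^sup>2"
      by simp
    finally have "\<epsilon> * (b * \<bar>x * z * q\<bar>) \<le> \<epsilon> * c\<^sup>2 / 8 * q\<^sup>2 + b * k / (2 * lam) * z\<^sup>2"
      using Y[of b z] pos by (simp add: distrib_left)
    moreover have "\<epsilon> * (b * - (x * z * q)) \<le> \<epsilon> * (b * \<bar>x * z * q\<bar>)"
      using pos by (intro mult_left_mono) auto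
    ultimately show ?thesis by simp
  qed
  have force_term: "\<epsilon> * (x * h * q) \<le> \<epsilon> * c\<^sup>2 / 8 * q\<^sup>2 + 2 * \<epsilon> / c\<^sup>2 * h\<^sup>2"
  proof -
    have "\<epsilon> * (x * h * q) \<le> \<epsilon> * \<bar>x * h * q\<bar>"
      using pos by (intro mult_left_mono) auto
    then show ?thesis using Y[of 1 h] by (simp add: r_def distrib_left)
  qed
  have power_term: "p * h \<le> \<epsilon> / 4 * p\<^sup>2 + 1 / \<epsilon> * h\<^sup>2"
    using Young_weighted[of "\<epsilon> / 4" 1 p h] pos by simp
  have "lyap_source x p q z h + (b * (z * p) - b * k / lam * z\<^sup>2) =
      - \<epsilon> / 2 * p\<^sup>2 - \<epsilon> * c\<^sup>2 / 2 * q\<^sup>2 - b * k / lam * z\<^sup>2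
      + (- \<mu> * p\<^sup>2 - \<epsilon> * (\<mu> * (x * p * q))) + (- \<epsilon> * (b * (x * z * q))) + \<epsilon> * (x * h * q) + p * h"
    by (simp add: lyap_source_def power2_eq_square algebra_simps)
  also have "\<dots> \<le> - \<epsilon> / 2 * p\<^sup>2 - \<epsilon> * c\<^sup>2 / 2 * q\<^sup>2 - b * k / lam * z\<^sup>2
      + \<epsilon> * c\<^sup>2 / 8 * q\<^sup>2 + (\<epsilon> * c\<^sup>2 / 8 * q\<^sup>2 + b * k / (2 * lam) * z\<^sup>2)
      + (\<epsilon> * c\<^sup>2 / 8 * q\<^sup>2 + 2 * \<epsilon> / c\<^sup>2 * h\<^sup>2) + (\<epsilon> / 4 * p\<^sup>2 + 1 / \<epsilon> * h\<^sup>2)"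
    by (intro add_mono order_refl viscous_term thermal_term force_term power_term)
  also have "\<dots> = - \<epsilon> / 4 * p\<^sup>2 - \<epsilon> * c\<^sup>2 / 8 * q\<^sup>2 - b * k / (2 * lam) * z\<^sup>2 + gain_f * h\<^sup>2"
    by (simp add: gain_f_def field_simps)
  finally show ?thesis .
qed

text \<open>
  The boundary condition makes \<open>c\<^sup>2 q p\<close> contain \<open>- a c\<^sup>2 p\<^sup>2\<close>. Half of it absorbs the mixed term with
  \<open>h\<close>, and one quarter each the kinetic and the potential part of the multiplier flux.
\<close>

lemma flux_at_1:
  assumes q: "q = - a * p + h"
  shows "lyap_flux 1 p q \<le> gain_d * h\<^sup>2"
proof -
  have sq: "q\<^sup>2 \<le> 2 * (a\<^sup>2 * p\<^sup>2 + h\<^sup>2)"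
    using sum_squares_ge_zero[of "a * p + h" 0]
    by (simp add: q power2_eq_square algebra_simps)
  have "c\<^sup>2 * (p * h) \<le> c\<^sup>2 * (a / 2 * p\<^sup>2 + h\<^sup>2 / (4 * (a / 2)))"
    using Young_weighted[of "a / 2" 1 p h] pos by (intro mult_left_mono) auto
  then have cross: "c\<^sup>2 * (p * h) \<le> a * c\<^sup>2 / 2 * p\<^sup>2 + c\<^sup>2 / (2 * a) * h\<^sup>2"
    by (simp add: field_simps)
  have kinetic: "\<epsilon> / 2 * p\<^sup>2 \<le> a * c\<^sup>2 / 4 * p\<^sup>2"
    using boundary_kinetic by (intro mult_right_mono) auto
  have potential: "\<epsilon> * (c\<^sup>2 * (a\<^sup>2 * p\<^sup>2)) \<le> a * c\<^sup>2 / 4 * p\<^sup>2"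
  proof -
    have "\<epsilon> * (c\<^sup>2 * (a\<^sup>2 * p\<^sup>2)) = (4 * a * \<epsilon>) * (a * c\<^sup>2 / 4 * p\<^sup>2)"
      by (simp add: power2_eq_square)
    also have "\<dots> \<le> 1 * (a * c\<^sup>2 / 4 * p\<^sup>2)"
      using boundary_potential pos by (intro mult_right_mono) auto
    finally show ?thesis by simp
  qed
  have "\<epsilon> * (c\<^sup>2 * q\<^sup>2 / 2) \<le> \<epsilon> * (c\<^sup>2 * (2 * (a\<^sup>2 * p\<^sup>2 + h\<^sup>2)) / 2)"
    using sq pos by (intro mult_left_mono divide_right_mono) auto
  then have "\<epsilon> * (c\<^sup>2 * q\<^sup>2 / 2) \<le> a * c\<^sup>2 / 4 * p\<^sup>2 + \<epsilon> * c\<^sup>2 * h\<^sup>2"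
    using potential by (simp add: distrib_left)
  moreover have "lyap_flux 1 p q = - (a * c\<^sup>2) * p\<^sup>2 + c\<^sup>2 * (p * h) + \<epsilon> / 2 * p\<^sup>2 + \<epsilon> * (c\<^sup>2 * q\<^sup>2 / 2)"
    unfolding lyap_flux_def by (subst (1) q) (simp add: power2_eq_square algebra_simps)
  ultimately have "lyap_flux 1 p q \<le> c\<^sup>2 / (2 * a) * h\<^sup>2 + \<epsilon> * c\<^sup>2 * h\<^sup>2"
    using cross kinetic by (simp add: field_simps)
  then show ?thesis by (simp add: gain_d_def distrib_right)
qed

lemma density_deriv:
  assumes p: "(p has_real_derivative p') (at s)" and q: "(q has_real_derivative q') (at s)"
  shows "((\<lambda>s. lyap_density x (p s) (q s)) has_real_derivative
    p s * p' + c\<^sup>2 * (q s * q') + \<epsilon> * (x * (p' * q s + p s * q'))) (at s)"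
proof -
  have "((\<lambda>s. p s * p s / 2 + c\<^sup>2 * (q s * q s) / 2 + \<epsilon> * (x * p s * q s)) has_real_derivative
      (p' * p s + p' * p s) / 2 + c\<^sup>2 * (q' * q s + q' * q s) / 2
        + \<epsilon> * (x * p' * q s + q' * (x * p s))) (at s)"
    by (intro DERIV_add DERIV_cdivide DERIV_cmult DERIV_mult p q)
  then show ?thesis
    unfolding lyap_density_def power2_eq_square[of "p _"] power2_eq_square[of "q _"]
    by (rule DERIV_cong) (simp add: field_simps)
qed

lemma flux_deriv:
  assumes p: "(p has_real_derivative p') (at x)" and q: "(q has_real_derivative q') (at x)"
  shows "((\<lambda>x. lyap_flux x (p x) (q x)) has_real_derivative c\<^sup>2 * (q' * p x + q x * p')
    + \<epsilon> * ((p x)\<^sup>2 / 2 + c\<^sup>2 * (q x)\<^sup>2 / 2 + x * (p x * p' + c\<^sup>2 * (q x * q')))) (at x)"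
proof -
  have "((\<lambda>x. c\<^sup>2 * (q x * p x) + \<epsilon> * (x * (p x * p x / 2 + c\<^sup>2 * (q x * q x) / 2))) has_real_derivative
      c\<^sup>2 * (q' * p x + p' * q x) + \<epsilon> * (1 * (p x * p x / 2 + c\<^sup>2 * (q x * q x) / 2)
        + ((p' * p x + p' * p x) / 2 + c\<^sup>2 * (q' * q x + q' * q x) / 2) * x)) (at x)"
    by (intro DERIV_add DERIV_cdivide DERIV_cmult DERIV_mult DERIV_ident p q)
  then show ?thesis
    unfolding lyap_flux_def power2_eq_square[of "p _"] power2_eq_square[of "q _"]
    by (rule DERIV_cong) (simp add: field_simps)
qed

end

text \<open>The function \<open>exp (r x) (E x - M / r)\<close> is nonincreasing.\<close>

lemma exponential_comparison:
  fixes E E' :: "real \<Rightarrow> real"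
  assumes r: "0 < r" and M: "0 \<le> M" and s: "s \<le> t"
    and deriv: "\<And>x. s \<le> x \<Longrightarrow> x \<le> t \<Longrightarrow> (E has_real_derivative E' x) (at x)"
    and bound: "\<And>x. s \<le> x \<Longrightarrow> x \<le> t \<Longrightarrow> E' x \<le> - r * E x + M"
  shows "E t \<le> exp (- r * (t - s)) * E s + M / r"
proof -
  have "exp (r * t) * (E t - M / r) \<le> exp (r * s) * (E s - M / r)"
  proof (rule DERIV_nonpos_imp_nonincreasing[OF s])
    fix x assume x: "s \<le> x" "x \<le> t"
    have "((\<lambda>x. exp (r * x) * (E x - M / r)) has_real_derivative
        exp (r * x) * r * (E x - M / r) + (E' x - 0) * exp (r * x)) (at x)"
    proof (intro DERIV_mult DERIV_diff deriv x DERIV_const)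
      show "((\<lambda>x. exp (r * x)) has_real_derivative exp (r * x) * r) (at x)"
        by (auto intro!: derivative_eq_intros)
    qed
    moreover have "exp (r * x) * r * (E x - M / r) + (E' x - 0) * exp (r * x)
        = exp (r * x) * (E' x + r * E x - M)"
      using r by (simp add: field_simps)
    moreover have "exp (r * x) * (E' x + r * E x - M) \<le> 0"
      using bound[OF x] by (intro mult_nonneg_nonpos) auto
    ultimately show "\<exists>y. ((\<lambda>x. exp (r * x) * (E x - M / r)) has_real_derivative y) (at x) \<and> y \<le> 0"
      by auto
  qed
  then have "exp (- (r * t)) * (exp (r * t) * (E t - M / r)) \<le> exp (- (r * t)) * (exp (r * s) * (E s - M / r))"
    by (intro mult_left_mono) auto
  moreover have "exp (- (r * t)) * exp (r * t) = 1"
    "exp (- (r * t)) * exp (r * s) = exp (- r * (t - s))"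
    by (simp_all add: exp_add[symmetric] right_diff_distrib)
  ultimately have "E t - M / r \<le> exp (- r * (t - s)) * (E s - M / r)"
    by (simp only: mult.assoc[symmetric] mult_1)
  also have "\<dots> \<le> exp (- r * (t - s)) * E s"
    using M r by simp
  finally show ?thesis by simp
qed

section \<open>The energy estimate for solutions\<close>

text \<open>
  The properties of a solution on which the energy estimate rests. The heat equation enters only
  through the flux \<open>k \<theta>\<^sub>x - \<lambda> u\<^sub>t\<close>, and \<open>uxt\<close> is the common value of the mixed derivatives.
\<close>

locale wave_heat_solution = lyapunov_weight a c \<mu> b k lam \<epsilon>
  for a c \<mu> b k lam \<epsilon> :: real +
  fixes f ut ux utt uxt uxx \<theta> \<theta>t \<theta>x :: "real \<times> real \<Rightarrow> real" and d :: "real \<Rightarrow> real"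
  assumes f_L2: "0 \<le> t \<Longrightarrow> (\<lambda>x. f (t, x)) \<in> L2"
    and f_cont: "continuous_on open_strip f"
    and ut_cont: "continuous_on closed_strip ut" and ux_cont: "continuous_on closed_strip ux"
    and utt_cont: "continuous_on open_strip utt" and uxt_cont: "continuous_on open_strip uxt"
    and uxx_cont: "continuous_on open_strip uxx"
    and ut_t: "0 < t \<Longrightarrow> 0 < x \<Longrightarrow> x < 1 \<Longrightarrow> ((\<lambda>s. ut (s, x)) has_real_derivative utt (t, x)) (at t)"
    and ut_x: "0 < t \<Longrightarrow> 0 < x \<Longrightarrow> x < 1 \<Longrightarrow> ((\<lambda>y. ut (t, y)) has_real_derivative uxt (t, x)) (at x)"
    and ux_t: "0 < t \<Longrightarrow> 0 < x \<Longrightarrow> x < 1 \<Longrightarrow> ((\<lambda>s. ux (s, x)) has_real_derivative uxt (t, x)) (at t)"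
    and ux_x: "0 < t \<Longrightarrow> 0 < x \<Longrightarrow> x < 1 \<Longrightarrow> ((\<lambda>y. ux (t, y)) has_real_derivative uxx (t, x)) (at x)"
    and \<theta>_cont: "continuous_on closed_strip \<theta>"
    and \<theta>_C1: "C1_L2 {0<..} (\<lambda>t x. \<theta> (t, x)) (\<lambda>t x. \<theta>t (t, x))"
    and \<theta>x_L2: "0 < t \<Longrightarrow> (\<lambda>x. \<theta>x (t, x)) \<in> L2"
    and \<theta>x_weak: "0 < t \<Longrightarrow> weak_deriv 1 (\<lambda>x. \<theta> (t, x)) (\<lambda>x. \<theta>x (t, x))"
    and heat_flux: "0 < t \<Longrightarrow>
      weak_deriv 1 (\<lambda>x. k * \<theta>x (t, x) - lam * ut (t, x)) (\<lambda>x. \<theta>t (t, x))"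
    and wave: "0 < t \<Longrightarrow> 0 < x \<Longrightarrow> x < 1 \<Longrightarrow>
      utt (t, x) = c\<^sup>2 * uxx (t, x) - \<mu> * ut (t, x) - b * \<theta>x (t, x) + f (t, x)"
    and ut_0: "0 < t \<Longrightarrow> ut (t, 0) = 0"
    and ux_1: "0 < t \<Longrightarrow> ux (t, 1) = - a * ut (t, 1) + d t"
    and \<theta>_0: "0 < t \<Longrightarrow> \<theta> (t, 0) = 0" and \<theta>_1: "0 < t \<Longrightarrow> \<theta> (t, 1) = 0"
begin

definition mech :: "real \<times> real \<Rightarrow> real" where
  "mech p = lyap_density (snd p) (ut p) (ux p)"

definition flow :: "real \<times> real \<Rightarrow> real" where
  "flow p = lyap_flux (snd p) (ut p) (ux p)"

definition thermal_energy :: "real \<Rightarrow> real" where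
  "thermal_energy t = b / (2 * lam) * (norm2 (\<lambda>x. \<theta> (t, x)))\<^sup>2"

definition lyap :: "real \<Rightarrow> real" where
  "lyap t = integral {0..1} (\<lambda>x. mech (t, x)) + thermal_energy t"

definition lyap_cut :: "real \<Rightarrow> real \<Rightarrow> real" where
  "lyap_cut \<delta> t = integral {\<delta>..1 - \<delta>} (\<lambda>x. mech (t, x)) + thermal_energy t"

lemma mech_cont: "continuous_on closed_strip mech"
  unfolding mech_def lyap_density_def by (intro continuous_intros ut_cont ux_cont) simp_all

lemma flow_cont: "continuous_on closed_strip flow"
  unfolding flow_def lyap_flux_def by (intro continuous_intros ut_cont ux_cont) simp_all

lemma slice_closed:
  assumes "continuous_on closed_strip w" "0 \<le> t"
  shows "continuous_on {0..1} (\<lambda>x. w (t, x))"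
  by (rule continuous_on_time_slice[OF assms(1)]) (use assms(2) in simp)

lemma slice_open:
  assumes "continuous_on open_strip w" "0 < t"
  shows "continuous_on {0<..<1} (\<lambda>x. w (t, x))"
  by (rule continuous_on_time_slice[OF assms(1)]) (use assms(2) in simp)

lemma slice_closed_open:
  assumes "continuous_on closed_strip w" "0 \<le> t"
  shows "continuous_on {0<..<1} (\<lambda>x. w (t, x))"
  by (rule continuous_on_subset[OF slice_closed[OF assms]]) (simp add: greaterThanLessThan_subseteq_atLeastAtMost_iff)

text \<open>Continuity of \<open>\<theta>\<^sub>x\<close> is read off the wave equation, in which it is the only term not known to be continuous.\<close>

lemma \<theta>x_cont: "0 < t \<Longrightarrow> continuous_on {0<..<1} (\<lambda>x. \<theta>x (t, x))"
proof -
  assume t: "0 < t"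
  have "continuous_on {0<..<1} (\<lambda>x. (c\<^sup>2 * uxx (t, x) - \<mu> * ut (t, x) + f (t, x) - utt (t, x)) / b)"
    using pos t by (intro continuous_intros slice_open slice_closed_open uxx_cont ut_cont f_cont utt_cont) auto
  then show ?thesis
    by (rule continuous_on_eq) (use wave[OF t] pos in \<open>auto simp: field_simps\<close>)
qed

lemma \<theta>_L2: "0 < t \<Longrightarrow> (\<lambda>x. \<theta> (t, x)) \<in> L2"
  by (intro L2_continuous slice_closed \<theta>_cont) simp

lemma ut_L2: "0 \<le> t \<Longrightarrow> (\<lambda>x. ut (t, x)) \<in> L2"
  by (intro L2_continuous slice_closed ut_cont) simp

text \<open>
  For each fixed time this is the pairing of \<open>\<theta>\<close> with the weak derivative \<open>\<theta>\<^sub>t\<close> of the heat flux.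
\<close>

lemma thermal_energy_deriv:
  assumes t: "0 < t"
  shows "(thermal_energy has_real_derivative b / lam *
    (- k * (norm2 (\<lambda>x. \<theta>x (t, x)))\<^sup>2 + lam * (LINT x|unit_lebesgue. \<theta>x (t, x) * ut (t, x)))) (at t)"
proof -
  let ?z = "\<lambda>x. \<theta>x (t, x)" and ?p = "\<lambda>x. ut (t, x)"
  have zz: "integrable unit_lebesgue (\<lambda>x. ?z x * ?z x)" and zp: "integrable unit_lebesgue (\<lambda>x. ?z x * ?p x)"
    using t by (intro L2_mult_integrable \<theta>x_L2 ut_L2; simp)+
  have "(LINT x|unit_lebesgue. \<theta> (t, x) * \<theta>t (t, x)) =
      - (LINT x|unit_lebesgue. ?z x * (k * ?z x - lam * ?p x))"
  proof (rule weak_integration_by_parts)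
    show "continuous_on {0..1} (\<lambda>x. \<theta> (t, x))"
      using t by (intro slice_closed \<theta>_cont) simp
    show "(\<lambda>x. k * ?z x - lam * ?p x) \<in> L2"
      using t by (intro L2_diff L2_scale \<theta>x_L2 ut_L2) auto
    show "continuous_on {0<..<1} (\<lambda>x. k * ?z x - lam * ?p x)"
      using t by (intro continuous_intros \<theta>x_cont slice_closed_open ut_cont) auto
    show "(\<lambda>x. \<theta>t (t, x)) \<in> L2"
      using \<theta>_C1 t by (simp add: C1_L2_def C0_L2_def)
  qed (use t in \<open>simp_all only: \<theta>_0 \<theta>_1 \<theta>x_L2 \<theta>x_cont \<theta>x_weak heat_flux\<close>)
  also have "(LINT x|unit_lebesgue. ?z x * (k * ?z x - lam * ?p x)) =
      (LINT x|unit_lebesgue. k * (?z x * ?z x) - lam * (?z x * ?p x))"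
    by (simp add: algebra_simps)
  also have "\<dots> = k * (norm2 ?z)\<^sup>2 - lam * (LINT x|unit_lebesgue. ?z x * ?p x)"
  proof -
    have "(norm2 ?z)\<^sup>2 = (LINT x|unit_lebesgue. ?z x * ?z x)"
      unfolding norm2_sq by (simp add: power2_eq_square)
    then show ?thesis using zz zp by simp
  qed
  finally have pairing: "(LINT x|unit_lebesgue. \<theta> (t, x) * \<theta>t (t, x)) =
      - (k * (norm2 ?z)\<^sup>2 - lam * (LINT x|unit_lebesgue. ?z x * ?p x))" .
  have eq: "b / (2 * lam) * (2 * (LINT x|unit_lebesgue. \<theta> (t, x) * \<theta>t (t, x))) =
      b / lam * (- k * (norm2 ?z)\<^sup>2 + lam * (LINT x|unit_lebesgue. ?z x * ?p x))"
    unfolding pairing using pos by (simp add: field_simps)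
  have "((\<lambda>s. (norm2 (\<lambda>x. \<theta> (s, x)))\<^sup>2) has_real_derivative
      2 * (LINT x|unit_lebesgue. \<theta> (t, x) * \<theta>t (t, x))) (at t within {0<..})"
    using t by (intro C1_L2_norm2_sq_deriv[OF \<theta>_C1]) simp
  then have "((\<lambda>s. (norm2 (\<lambda>x. \<theta> (s, x)))\<^sup>2) has_real_derivative
      2 * (LINT x|unit_lebesgue. \<theta> (t, x) * \<theta>t (t, x))) (at t)"
    using t by (simp add: at_within_open[of t "{0<..}"])
  from DERIV_cmult[OF this, of "b / (2 * lam)"] show ?thesis
    unfolding thermal_energy_def[abs_def] eq .
qed

abbreviation remainder :: "real \<Rightarrow> real \<Rightarrow> real" where
  "remainder t x \<equiv> lyap_source x (ut (t, x)) (ux (t, x)) (\<theta>x (t, x)) (f (t, x))"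

lemma remainder_cont:
  assumes "0 < t"
  shows "continuous_on {0<..<1} (remainder t)"
proof -
  have t: "0 \<le> t" using assms by simp
  show ?thesis
    unfolding lyap_source_def
    by (intro continuous_intros \<theta>x_cont[OF assms] slice_closed_open[OF ut_cont t]
        slice_closed_open[OF ux_cont t] slice_open[OF f_cont assms])
qed

text \<open>
  Away from the lateral boundary \<open>u\<close> is twice continuously differentiable, so that the density may
  be differentiated under the integral; the wave equation turns the integrand into \<open>flow\<^sub>x\<close> plus
  terms without second derivatives.
\<close>

lemma mech_integral_deriv:
  assumes t: "0 < t" and \<delta>: "0 < \<delta>" "\<delta> < 1 / 2"
  shows "((\<lambda>s. integral {\<delta>..1 - \<delta>} (\<lambda>x. mech (s, x))) has_real_derivative
    flow (t, 1 - \<delta>) - flow (t, \<delta>) + integral {\<delta>..1 - \<delta>} (remainder t)) (at t)"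
proof -
  define mech_t where "mech_t p = ut p * utt p + c\<^sup>2 * (ux p * uxt p)
    + \<epsilon> * (snd p * (utt p * ux p + ut p * uxt p))" for p
  have sub: "{\<delta>..1 - \<delta>} \<subseteq> {0<..<1}" using \<delta> by auto
  have open_sub: "{0<..} \<times> {\<delta>..1 - \<delta>} \<subseteq> open_strip" "open_strip \<subseteq> closed_strip"
    using sub by auto
  have cont_t: "continuous_on ({0<..} \<times> {\<delta>..1 - \<delta>}) mech_t"
    unfolding mech_t_def
    by (intro continuous_intros continuous_on_subset[OF utt_cont] continuous_on_subset[OF uxt_cont]
        continuous_on_subset[OF ut_cont] continuous_on_subset[OF ux_cont] open_sub
        order_trans[OF open_sub])
  have "((\<lambda>s. integral (cbox \<delta> (1 - \<delta>)) (\<lambda>x. mech (s, x))) has_field_derivative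
      integral (cbox \<delta> (1 - \<delta>)) (\<lambda>x. mech_t (t, x))) (at t within {0<..})"
  proof (rule leibniz_rule_field_derivative)
    fix s x :: real assume sx: "s \<in> {0<..}" "x \<in> cbox \<delta> (1 - \<delta>)"
    then have x: "0 < s" "0 < x" "x < 1" using \<delta> by auto
    have "((\<lambda>s. mech (s, x)) has_real_derivative mech_t (s, x)) (at s)"
      unfolding mech_def mech_t_def snd_conv
      by (rule density_deriv[OF ut_t[OF x] ux_t[OF x]])
    then show "((\<lambda>s. mech (s, x)) has_real_derivative mech_t (s, x)) (at s within {0<..})"
      by (rule has_field_derivative_at_within)
  next
    fix s :: real assume "s \<in> {0<..}"
    then have "continuous_on {\<delta>..1 - \<delta>} (\<lambda>x. mech (s, x))"
      by (intro continuous_on_subset[OF slice_closed_open[OF mech_cont] sub]) simp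
    then show "(\<lambda>x. mech (s, x)) integrable_on cbox \<delta> (1 - \<delta>)"
      by (simp add: integrable_continuous_real)
  next
    show "continuous_on ({0<..} \<times> cbox \<delta> (1 - \<delta>)) (\<lambda>(s, x). mech_t (s, x))"
      using cont_t by simp
  qed (use t in auto)
  then have D: "((\<lambda>s. integral {\<delta>..1 - \<delta>} (\<lambda>x. mech (s, x))) has_real_derivative
      integral {\<delta>..1 - \<delta>} (\<lambda>x. mech_t (t, x))) (at t)"
    using t by (simp add: at_within_open[of t "{0<..}"])
  have "((\<lambda>x. mech_t (t, x) - remainder t x) has_integral flow (t, 1 - \<delta>) - flow (t, \<delta>)) {\<delta>..1 - \<delta>}"
  proof (rule fundamental_theorem_of_calculus)
    fix x assume "x \<in> {\<delta>..1 - \<delta>}"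
    then have x: "0 < x" "x < 1" using \<delta> by auto
    have "c\<^sup>2 * (uxx (t, x) * ut (t, x) + ux (t, x) * uxt (t, x))
        + \<epsilon> * ((ut (t, x))\<^sup>2 / 2 + c\<^sup>2 * (ux (t, x))\<^sup>2 / 2
          + x * (ut (t, x) * uxt (t, x) + c\<^sup>2 * (ux (t, x) * uxx (t, x))))
        = mech_t (t, x) - remainder t x"
      unfolding mech_t_def lyap_source_def snd_conv wave[OF t x]
      by (simp add: field_simps)
    then have "((\<lambda>x. flow (t, x)) has_real_derivative mech_t (t, x) - remainder t x) (at x)"
      using flux_deriv[OF ut_x[OF t x] ux_x[OF t x]] by (simp only: flow_def snd_conv)
    then show "((\<lambda>x. flow (t, x)) has_vector_derivative mech_t (t, x) - remainder t x) (at x within {\<delta>..1 - \<delta>})"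
      by (simp add: has_real_derivative_iff_has_vector_derivative[symmetric] has_field_derivative_at_within)
  qed (use \<delta> in simp)
  then have "integral {\<delta>..1 - \<delta>} (\<lambda>x. mech_t (t, x) - remainder t x) = flow (t, 1 - \<delta>) - flow (t, \<delta>)"
    by (rule integral_unique)
  moreover have "integral {\<delta>..1 - \<delta>} (\<lambda>x. mech_t (t, x) - remainder t x) =
      integral {\<delta>..1 - \<delta>} (\<lambda>x. mech_t (t, x)) - integral {\<delta>..1 - \<delta>} (remainder t)"
  proof (rule Henstock_Kurzweil_Integration.integral_diff)
    show "(\<lambda>x. mech_t (t, x)) integrable_on {\<delta>..1 - \<delta>}"
      using continuous_on_time_slice[OF cont_t, of t] t by (simp add: integrable_continuous_real)
    show "remainder t integrable_on {\<delta>..1 - \<delta>}"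
      by (intro integrable_continuous_real continuous_on_subset[OF remainder_cont[OF t] sub])
  qed
  ultimately have "integral {\<delta>..1 - \<delta>} (\<lambda>x. mech_t (t, x)) =
      flow (t, 1 - \<delta>) - flow (t, \<delta>) + integral {\<delta>..1 - \<delta>} (remainder t)"
    by simp
  then show ?thesis using D by simp
qed

text \<open>
  The thermal contribution involves all of the unit interval, the mechanical one only
  \<open>[\<delta>, 1 - \<delta>]\<close>. On the two end pieces the coupling term \<open>b \<theta>\<^sub>x u\<^sub>t\<close> is therefore not cancelled; it
  is split into half of the dissipation \<open>(b k / \<lambda>) \<theta>\<^sub>x\<^sup>2\<close> and a bounded rest, which contributes an
  error proportional to \<open>\<delta>\<close>.
\<close>

lemma truncated_dissipation:
  assumes t: "0 < t" and \<delta>: "0 < \<delta>" "\<delta> < 1 / 2" and B: "\<And>x. x \<in> {0..1} \<Longrightarrow> \<bar>ut (t, x)\<bar> \<le> B"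
  shows "integral {\<delta>..1 - \<delta>} (remainder t) + b / lam *
      (- k * (norm2 (\<lambda>x. \<theta>x (t, x)))\<^sup>2 + lam * (LINT x|unit_lebesgue. \<theta>x (t, x) * ut (t, x)))
    \<le> - rate * lyap_cut \<delta> t + gain_f * (norm2 (\<lambda>x. f (t, x)))\<^sup>2 + \<delta> * (b * lam / k * B\<^sup>2)"
proof -
  let ?z = "\<lambda>x. \<theta>x (t, x)" and ?p = "\<lambda>x. ut (t, x)" and ?h = "\<lambda>x. f (t, x)"
  let ?I = "{\<delta>..1 - \<delta>}"
  define K where "K = b * lam / (2 * k) * B\<^sup>2"
  define W where "W x = - rate * mech (t, x) - K" for x
  have sub: "?I \<subseteq> {0<..<1}" using \<delta> by auto
  have cut: "integrable unit_lebesgue (\<lambda>x. indicator ?I x * F x)"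
    "(LINT x|unit_lebesgue. indicator ?I x * F x) = integral ?I F"
    if "continuous_on {0<..<1} F" for F :: "real \<Rightarrow> real"
    using LINT_eq_integral_subinterval[OF _ _ continuous_on_subset[OF that sub],
        of "\<lambda>x. indicator ?I x * F x"] \<delta> by auto
  note R = cut[OF remainder_cont[OF t]]
  have W_cont: "continuous_on {0<..<1} W"
    unfolding W_def using t by (intro continuous_intros slice_closed_open mech_cont) simp
  have zp: "integrable unit_lebesgue (\<lambda>x. ?z x * ?p x)" and zz: "integrable unit_lebesgue (\<lambda>x. (?z x)\<^sup>2)"
    and hh: "integrable unit_lebesgue (\<lambda>x. (?h x)\<^sup>2)"
    using t by (intro L2_mult_integrable L2_integrable_square \<theta>x_L2 ut_L2 f_L2; simp)+
  have bound: "indicator ?I x * remainder t x + (b * (?z x * ?p x) - b * k / lam * (?z x)\<^sup>2)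
      \<le> indicator ?I x * W x + K + gain_f * (?h x)\<^sup>2 - b * k / (2 * lam) * (?z x)\<^sup>2"
    if x: "x \<in> space unit_lebesgue" for x
  proof (cases "x \<in> ?I")
    case True
    have x01: "0 \<le> x" "x \<le> 1" using x by auto
    show ?thesis
      using source_bound[OF x01, of "?p x" "ux (t, x)" "?z x" "?h x"]
        density_decay[OF x01, of "?p x" "ux (t, x)"] True
      by (simp add: W_def mech_def)
  next
    case False
    have "\<bar>1 * ?z x * ?p x\<bar> \<le> k / (2 * lam) * (?z x)\<^sup>2 + (?p x)\<^sup>2 / (4 * (k / (2 * lam)))"
      using pos by (intro Young_weighted) auto
    then have "b * \<bar>?z x * ?p x\<bar> \<le> b * (k / (2 * lam) * (?z x)\<^sup>2 + (?p x)\<^sup>2 / (4 * (k / (2 * lam))))"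
      using pos by (intro mult_left_mono) auto
    also have "\<dots> = b * k / (2 * lam) * (?z x)\<^sup>2 + b * lam / (2 * k) * (?p x)\<^sup>2"
      using pos by (simp add: field_simps)
    also have "\<dots> \<le> b * k / (2 * lam) * (?z x)\<^sup>2 + K"
    proof -
      have "(?p x)\<^sup>2 \<le> B\<^sup>2"
        using power_mono[OF B[of x], of 2] x by auto
      then show ?thesis
        unfolding K_def using pos by (intro add_left_mono mult_left_mono) auto
    qed
    finally have "b * \<bar>?z x * ?p x\<bar> \<le> b * k / (2 * lam) * (?z x)\<^sup>2 + K" .
    moreover have "b * (?z x * ?p x) \<le> b * \<bar>?z x * ?p x\<bar>"
      using pos by (intro mult_left_mono) auto
    moreover have "b * k / lam * (?z x)\<^sup>2 = b * k / (2 * lam) * (?z x)\<^sup>2 + b * k / (2 * lam) * (?z x)\<^sup>2"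
      using pos by (simp add: field_simps)
    moreover have "0 \<le> gain_f * (?h x)\<^sup>2"
      using gain_f_pos by simp
    ultimately show ?thesis
      using False by simp
  qed
  have "integral ?I (remainder t) + b / lam * (- k * (norm2 ?z)\<^sup>2 + lam * (LINT x|unit_lebesgue. ?z x * ?p x))
      = (LINT x|unit_lebesgue. indicator ?I x * remainder t x + (b * (?z x * ?p x) - b * k / lam * (?z x)\<^sup>2))"
    using R zp zz pos by (simp add: norm2_sq field_simps)
  also have "\<dots> \<le> (LINT x|unit_lebesgue.
      indicator ?I x * W x + K + gain_f * (?h x)\<^sup>2 - b * k / (2 * lam) * (?z x)\<^sup>2)"
  proof (rule Bochner_Integration.integral_mono[OF _ _ bound])
    show "integrable unit_lebesgue
        (\<lambda>x. indicator ?I x * remainder t x + (b * (?z x * ?p x) - b * k / lam * (?z x)\<^sup>2))"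
      by (intro Bochner_Integration.integrable_add Bochner_Integration.integrable_diff
          integrable_mult_right R zp zz)
    show "integrable unit_lebesgue
        (\<lambda>x. indicator ?I x * W x + K + gain_f * (?h x)\<^sup>2 - b * k / (2 * lam) * (?z x)\<^sup>2)"
      by (intro Bochner_Integration.integrable_add Bochner_Integration.integrable_diff
          integrable_mult_right cut W_cont integrable_unit_const hh zz)
  qed
  also have "\<dots> = integral ?I W + K + gain_f * (norm2 ?h)\<^sup>2 - b * k / (2 * lam) * (norm2 ?z)\<^sup>2"
    unfolding norm2_sq cut(2)[OF W_cont, symmetric]
    using cut(1)[OF W_cont] hh zz integral_unit_const[of K]
    by (simp del: integral_unit_const Bochner_Integration.lebesgue_integral_const)
  finally have main: "integral ?I (remainder t) + b / lam *
      (- k * (norm2 ?z)\<^sup>2 + lam * (LINT x|unit_lebesgue. ?z x * ?p x))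
      \<le> integral ?I W + K + gain_f * (norm2 ?h)\<^sup>2 - b * k / (2 * lam) * (norm2 ?z)\<^sup>2" .
  have W_int: "integral ?I W = - rate * integral ?I (\<lambda>x. mech (t, x)) - K * (1 - 2 * \<delta>)"
  proof -
    have "(\<lambda>x. mech (t, x)) integrable_on ?I"
      using t by (intro integrable_continuous_real continuous_on_subset[OF slice_closed_open[OF mech_cont] sub]) simp
    then have "integral ?I W = integral ?I (\<lambda>x. - rate * mech (t, x)) - integral ?I (\<lambda>x. K)"
      unfolding W_def by (intro Henstock_Kurzweil_Integration.integral_diff integrable_on_mult_right
          integrable_const_ivl)
    then show ?thesis using \<delta> by simp
  qed
  have thermal_decay: "rate * thermal_energy t \<le> b * k / (2 * lam) * (norm2 ?z)\<^sup>2"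
  proof -
    have "norm2 (\<lambda>x. \<theta> (t, x)) \<le> norm2 ?z"
      using t by (intro Poincare_inequality slice_closed \<theta>_cont \<theta>_0 \<theta>x_L2 \<theta>x_weak) auto
    then have "(norm2 (\<lambda>x. \<theta> (t, x)))\<^sup>2 \<le> (norm2 ?z)\<^sup>2"
      by (intro power_mono norm2_nonneg)
    then have "rate * (b / (2 * lam) * (norm2 (\<lambda>x. \<theta> (t, x)))\<^sup>2) \<le> k * (b / (2 * lam) * (norm2 ?z)\<^sup>2)"
      using pos rate_pos by (intro mult_mono) (auto simp: rate_def)
    moreover have "k * (b / (2 * lam) * (norm2 ?z)\<^sup>2) = b * k / (2 * lam) * (norm2 ?z)\<^sup>2"
      by simp
    ultimately show ?thesis
      by (simp only: thermal_energy_def)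
  qed
  have K2: "b * lam / k * B\<^sup>2 = 2 * K"
    by (simp add: K_def)
  have "integral ?I W + K = - rate * integral ?I (\<lambda>x. mech (t, x)) + \<delta> * (b * lam / k * B\<^sup>2)"
    unfolding W_int K2 by (simp add: algebra_simps)
  then show ?thesis
    using main thermal_decay unfolding lyap_cut_def distrib_left by linarith
qed

end

context lyapunov_weight
begin

text \<open>Constants of the equivalence between the functional and the squared norm of the state.\<close>

definition lower :: real where "lower = min (1 / 4) (min (c\<^sup>2 / 4) (b / (2 * lam)))"
definition upper :: real where "upper = 3 / 4 + 3 * c\<^sup>2 / 4 + b / (2 * lam)"

lemma lower_pos: "0 < lower" and upper_pos: "0 < upper"
  using pos by (auto simp: lower_def upper_def intro!: add_pos_pos)

end

context wave_heat_solution
begin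

lemma lyap_cut_tendsto:
  assumes "0 \<le> t"
  shows "(\<lambda>n. lyap_cut (unit_cut n) t) \<longlonglongrightarrow> lyap t"
proof -
  note mech = unit_integral_continuous[OF slice_closed[OF mech_cont assms]]
  show ?thesis
    unfolding lyap_cut_def lyap_def mech(2)[symmetric]
    by (intro tendsto_add tendsto_const unit_integral_cut_tendsto mech(1))
qed

text \<open>
  On \<open>[s, t]\<close> with \<open>s > 0\<close> the boundary values of \<open>flow\<close> are attained uniformly as the strip is
  exhausted, so the truncated functionals satisfy the differential inequality up to a small error.
\<close>

lemma lyap_decay_positive_time:
  assumes st: "0 < s" "s \<le> t"
    and N: "\<And>r. s \<le> r \<Longrightarrow> r \<le> t \<Longrightarrow> norm2 (\<lambda>x. f (r, x)) \<le> N"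
    and D: "\<And>r. s \<le> r \<Longrightarrow> r \<le> t \<Longrightarrow> \<bar>d r\<bar> \<le> D"
  shows "lyap t \<le> exp (- rate * (t - s)) * lyap s + (gain_f * N\<^sup>2 + gain_d * D\<^sup>2) / rate"
proof (rule field_le_epsilon)
  fix e' :: real assume "0 < e'"
  define e where "e = e' * rate"
  have e: "0 < e" "e / rate = e'" using \<open>0 < e'\<close> rate_pos by (auto simp: e_def)
  define R where "R = {s..t} \<times> {0..1::real}"
  define M where "M = gain_f * N\<^sup>2 + gain_d * D\<^sup>2"
  have R: "compact R" "R \<subseteq> closed_strip"
    using st by (auto simp: R_def intro: compact_Times)
  have "bounded (ut ` R)"
    by (intro compact_imp_bounded compact_continuous_image continuous_on_subset[OF ut_cont] R)
  then obtain B where B: "\<forall>p\<in>ut ` R. norm p \<le> B"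
    unfolding bounded_iff by blast
  have "uniformly_continuous_on R flow"
    by (intro compact_uniformly_continuous continuous_on_subset[OF flow_cont] R)
  \<comment> \<open>The error \<open>e\<close> is shared by the two boundary fluxes and the truncated coupling term.\<close>
  moreover have "0 < e / 3" using e by simp
  ultimately obtain \<eta> where \<eta>: "0 < \<eta>"
    "\<And>p p'. p \<in> R \<Longrightarrow> p' \<in> R \<Longrightarrow> dist p' p < \<eta> \<Longrightarrow> dist (flow p') (flow p) < e / 3"
    unfolding uniformly_continuous_on_def by meson
  have "\<forall>\<^sub>F n in sequentially. unit_cut n < \<eta>"
    by (rule order_tendstoD(2)[OF unit_cut_tendsto \<eta>(1)])
  moreover have "\<forall>\<^sub>F n in sequentially. unit_cut n * (b * lam / k * B\<^sup>2) < e / 3"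
    using tendsto_mult[OF unit_cut_tendsto tendsto_const, of "b * lam / k * B\<^sup>2"] e(1)
    by (intro order_tendstoD(2)[where y = 0]) simp_all
  ultimately have "\<forall>\<^sub>F n in sequentially. lyap_cut (unit_cut n) t
      \<le> exp (- rate * (t - s)) * lyap_cut (unit_cut n) s + (M + e) / rate"
  proof eventually_elim
    case (elim n)
    define \<delta> where "\<delta> = unit_cut n"
    have \<delta>: "0 < \<delta>" "\<delta> < 1 / 2" "\<delta> < \<eta>" "\<delta> * (b * lam / k * B\<^sup>2) < e / 3"
      using elim unit_cut_bounds[of n] by (auto simp: \<delta>_def)
    show ?case
      unfolding \<delta>_def[symmetric]
    proof (rule exponential_comparison[OF rate_pos _ st(2)])
      show "0 \<le> M + e"
        using e gain_f_pos gain_d_pos by (simp add: M_def)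
      fix r assume r: "s \<le> r" "r \<le> t"
      have r0: "0 < r" using r st by simp
      show "(lyap_cut \<delta> has_real_derivative (flow (r, 1 - \<delta>) - flow (r, \<delta>)
          + integral {\<delta>..1 - \<delta>} (remainder r)) + b / lam * (- k * (norm2 (\<lambda>x. \<theta>x (r, x)))\<^sup>2
          + lam * (LINT x|unit_lebesgue. \<theta>x (r, x) * ut (r, x)))) (at r)"
        unfolding lyap_cut_def[abs_def]
        by (intro DERIV_add mech_integral_deriv thermal_energy_deriv r0 \<delta>)
      have "\<bar>ut (r, x)\<bar> \<le> B" if "x \<in> {0..1}" for x
        using B r that by (auto simp: R_def)
      from truncated_dissipation[OF r0 \<delta>(1,2) this]
      have dissipation: "integral {\<delta>..1 - \<delta>} (remainder r) + b / lam *
          (- k * (norm2 (\<lambda>x. \<theta>x (r, x)))\<^sup>2 + lam * (LINT x|unit_lebesgue. \<theta>x (r, x) * ut (r, x)))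
          \<le> - rate * lyap_cut \<delta> r + gain_f * (norm2 (\<lambda>x. f (r, x)))\<^sup>2 + \<delta> * (b * lam / k * B\<^sup>2)" .
      have in_R: "(r, 0) \<in> R" "(r, 1) \<in> R" "(r, \<delta>) \<in> R" "(r, 1 - \<delta>) \<in> R"
        using r \<delta> by (auto simp: R_def)
      have "dist (flow (r, 1 - \<delta>)) (flow (r, 1)) < e / 3" "dist (flow (r, \<delta>)) (flow (r, 0)) < e / 3"
        by (rule \<eta>(2)[OF in_R(2,4)] \<eta>(2)[OF in_R(1,3)];
            use \<delta> in \<open>simp add: dist_Pair_Pair dist_real_def\<close>)+
      moreover have "flow (r, 0) = 0"
        using ut_0[OF r0] by (simp add: flow_def lyap_flux_def)
      moreover have "flow (r, 1) \<le> gain_d * (d r)\<^sup>2"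
        using flux_at_1[OF ux_1[OF r0]] by (simp add: flow_def)
      moreover have "gain_d * (d r)\<^sup>2 \<le> gain_d * D\<^sup>2"
        using power_mono[OF D[OF r], of 2] gain_d_pos by simp
      moreover have "gain_f * (norm2 (\<lambda>x. f (r, x)))\<^sup>2 \<le> gain_f * N\<^sup>2"
        using power_mono[OF N[OF r] norm2_nonneg, of 2] gain_f_pos by simp
      ultimately show "(flow (r, 1 - \<delta>) - flow (r, \<delta>) + integral {\<delta>..1 - \<delta>} (remainder r))
          + b / lam * (- k * (norm2 (\<lambda>x. \<theta>x (r, x)))\<^sup>2
          + lam * (LINT x|unit_lebesgue. \<theta>x (r, x) * ut (r, x))) \<le> - rate * lyap_cut \<delta> r + (M + e)"
        using dissipation \<delta>(4) unfolding M_def dist_real_def by linarith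
    qed
  qed
  moreover have "(\<lambda>n. lyap_cut (unit_cut n) t) \<longlonglongrightarrow> lyap t"
    "(\<lambda>n. lyap_cut (unit_cut n) s) \<longlonglongrightarrow> lyap s"
    using st by (intro lyap_cut_tendsto; simp)+
  moreover from this(2) have "(\<lambda>n. exp (- rate * (t - s)) * lyap_cut (unit_cut n) s + (M + e) / rate)
      \<longlonglongrightarrow> exp (- rate * (t - s)) * lyap s + (M + e) / rate"
    by (intro tendsto_intros)
  ultimately have "lyap t \<le> exp (- rate * (t - s)) * lyap s + (M + e) / rate"
    using tendsto_le[OF sequentially_bot] by blast
  then show "lyap t \<le> exp (- rate * (t - s)) * lyap s + (gain_f * N\<^sup>2 + gain_d * D\<^sup>2) / rate + e'"
    using e(2) by (simp add: M_def add_divide_distrib)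
qed

lemma lyap_continuous: "continuous_on {0..} lyap"
proof -
  have param: "continuous_on {0..} (\<lambda>t. integral {0..1} (\<lambda>x. w (t, x)))"
    if "continuous_on closed_strip w" for w :: "real \<times> real \<Rightarrow> real"
  proof -
    have "continuous_on ({0..} \<times> cbox 0 1) (\<lambda>(t, x). w (t, x))"
      using that by simp
    from integral_continuous_on_param[OF this] show ?thesis by simp
  qed
  have "continuous_on {0..} (\<lambda>t. integral {0..1} (\<lambda>x. mech (t, x))
      + b / (2 * lam) * integral {0..1} (\<lambda>x. (\<theta> (t, x))\<^sup>2))"
    using param[OF mech_cont] param[OF continuous_on_power[OF \<theta>_cont], of 2]
    by (intro continuous_on_add continuous_on_mult continuous_on_const)
  then show ?thesis
    by (rule continuous_on_eq)
      (simp add: lyap_def thermal_energy_def norm2_continuous[OF slice_closed[OF \<theta>_cont]])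
qed

text \<open>The initial time is reached by continuity, as the equations hold for positive times only.\<close>

lemma lyap_decay:
  assumes t: "0 \<le> t"
    and N: "\<And>r. 0 \<le> r \<Longrightarrow> r \<le> t \<Longrightarrow> norm2 (\<lambda>x. f (r, x)) \<le> N"
    and D: "\<And>r. 0 \<le> r \<Longrightarrow> r \<le> t \<Longrightarrow> \<bar>d r\<bar> \<le> D"
  shows "lyap t \<le> exp (- rate * t) * lyap 0 + (gain_f * N\<^sup>2 + gain_d * D\<^sup>2) / rate"
proof (cases "t = 0")
  case True
  then show ?thesis using gain_f_pos gain_d_pos rate_pos by simp
next
  case False
  then have "0 < t" using t by simp
  have "continuous_on {0..t} lyap"
    by (rule continuous_on_subset[OF lyap_continuous]) auto
  from continuous_on_Icc_at_rightD[OF this \<open>0 < t\<close>]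
  have "((\<lambda>s. exp (- rate * (t - s)) * lyap s + (gain_f * N\<^sup>2 + gain_d * D\<^sup>2) / rate) \<longlongrightarrow>
      exp (- rate * (t - 0)) * lyap 0 + (gain_f * N\<^sup>2 + gain_d * D\<^sup>2) / rate) (at_right 0)"
    by (intro tendsto_intros)
  moreover have "\<forall>\<^sub>F s in at_right 0.
      lyap t \<le> exp (- rate * (t - s)) * lyap s + (gain_f * N\<^sup>2 + gain_d * D\<^sup>2) / rate"
    using eventually_at_right_real[OF \<open>0 < t\<close>]
  proof eventually_elim
    case (elim s)
    then show ?case by (intro lyap_decay_positive_time N D) auto
  qed
  ultimately have "lyap t \<le> exp (- rate * (t - 0)) * lyap 0 + (gain_f * N\<^sup>2 + gain_d * D\<^sup>2) / rate"
    by (rule tendsto_lowerbound) simp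
  then show ?thesis by simp
qed

definition state_sq :: "real \<Rightarrow> real" where
  "state_sq t = (norm2 (\<lambda>x. ut (t, x)))\<^sup>2 + (norm2 (\<lambda>x. ux (t, x)))\<^sup>2 + (norm2 (\<lambda>x. \<theta> (t, x)))\<^sup>2"

lemma lyap_equivalent:
  assumes t: "0 \<le> t"
  shows "lower * state_sq t \<le> lyap t" "lyap t \<le> upper * state_sq t"
proof -
  let ?P = "(norm2 (\<lambda>x. ut (t, x)))\<^sup>2" and ?Q = "(norm2 (\<lambda>x. ux (t, x)))\<^sup>2"
    and ?T = "(norm2 (\<lambda>x. \<theta> (t, x)))\<^sup>2" and ?E = "integral {0..1} (\<lambda>x. mech (t, x))"
  note ut = slice_closed[OF ut_cont t] and ux = slice_closed[OF ux_cont t]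
  have int: "(\<lambda>x. (ut (t, x))\<^sup>2) integrable_on {0..1}" "(\<lambda>x. (ux (t, x))\<^sup>2) integrable_on {0..1}"
    "(\<lambda>x. mech (t, x)) integrable_on {0..1}"
    by (intro integrable_continuous_real continuous_on_power ut ux slice_closed[OF mech_cont t])+
  have eq: "integral {0..1} (\<lambda>x. r * ((ut (t, x))\<^sup>2 + c\<^sup>2 * (ux (t, x))\<^sup>2)) = r * (?P + c\<^sup>2 * ?Q)" for r
    unfolding norm2_continuous[OF ut] norm2_continuous[OF ux] using int
    by (simp add: Henstock_Kurzweil_Integration.integral_add integrable_on_mult_right)
  have int2: "(\<lambda>x. r * ((ut (t, x))\<^sup>2 + c\<^sup>2 * (ux (t, x))\<^sup>2)) integrable_on {0..1}" for r
    using int by (intro integrable_on_mult_right Henstock_Kurzweil_Integration.integrable_add)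
  have low: "1 / 4 * (?P + c\<^sup>2 * ?Q) \<le> ?E"
    unfolding eq[symmetric]
  proof (rule integral_le[OF int2 int(3)])
    fix x :: real assume "x \<in> {0..1}"
    then show "1 / 4 * ((ut (t, x))\<^sup>2 + c\<^sup>2 * (ux (t, x))\<^sup>2) \<le> mech (t, x)"
      using density_bounds(1)[of x "ut (t, x)" "ux (t, x)"] by (simp add: mech_def)
  qed
  have up: "?E \<le> 3 / 4 * (?P + c\<^sup>2 * ?Q)"
    unfolding eq[symmetric]
  proof (rule integral_le[OF int(3) int2])
    fix x :: real assume "x \<in> {0..1}"
    then show "mech (t, x) \<le> 3 / 4 * ((ut (t, x))\<^sup>2 + c\<^sup>2 * (ux (t, x))\<^sup>2)"
      using density_bounds(2)[of x "ut (t, x)" "ux (t, x)"] by (simp add: mech_def)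
  qed
  have "lower * ?P \<le> 1 / 4 * ?P" "lower * ?Q \<le> c\<^sup>2 / 4 * ?Q" "lower * ?T \<le> b / (2 * lam) * ?T"
    by (intro mult_right_mono; simp add: lower_def)+
  then show "lower * state_sq t \<le> lyap t"
    using low unfolding lyap_def thermal_energy_def state_sq_def distrib_left by linarith
  have "3 / 4 * ?P \<le> upper * ?P" "3 * c\<^sup>2 / 4 * ?Q \<le> upper * ?Q" "b / (2 * lam) * ?T \<le> upper * ?T"
    using pos by (intro mult_right_mono; simp add: upper_def)+
  then show "lyap t \<le> upper * state_sq t"
    using up unfolding lyap_def thermal_energy_def state_sq_def distrib_left by linarith
qed

lemma state_estimate:
  assumes t: "0 \<le> t" and ND: "0 \<le> N" "0 \<le> D"
    and N: "\<And>r. 0 \<le> r \<Longrightarrow> r \<le> t \<Longrightarrow> norm2 (\<lambda>x. f (r, x)) \<le> N"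
    and D: "\<And>r. 0 \<le> r \<Longrightarrow> r \<le> t \<Longrightarrow> \<bar>d r\<bar> \<le> D"
  shows "sqrt (state_sq t) \<le> sqrt (upper / lower) * exp (- (rate / 2) * t) * sqrt (state_sq 0)
    + sqrt (gain_f / (rate * lower)) * N + sqrt (gain_d / (rate * lower)) * D"
proof -
  let ?A = "sqrt (upper / lower) * exp (- (rate / 2) * t) * sqrt (state_sq 0)"
    and ?B = "sqrt (gain_f / (rate * lower)) * N" and ?C = "sqrt (gain_d / (rate * lower)) * D"
  have S0: "0 \<le> state_sq 0" by (simp add: state_sq_def)
  have nonneg: "0 \<le> ?A" "0 \<le> ?B" "0 \<le> ?C"
    using ND S0 lower_pos upper_pos rate_pos gain_f_pos gain_d_pos by simp_all
  have "lower * state_sq t \<le> exp (- rate * t) * lyap 0 + (gain_f * N\<^sup>2 + gain_d * D\<^sup>2) / rate"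
    using lyap_equivalent(1)[OF t] lyap_decay[OF t N D] by simp
  also have "\<dots> \<le> exp (- rate * t) * (upper * state_sq 0) + (gain_f * N\<^sup>2 + gain_d * D\<^sup>2) / rate"
    using lyap_equivalent(2)[of 0] by (intro add_right_mono mult_left_mono) auto
  also have "\<dots> = lower * (?A\<^sup>2 + ?B\<^sup>2 + ?C\<^sup>2)"
  proof -
    have "(exp (- (rate / 2) * t))\<^sup>2 = exp (- rate * t)"
      by (simp add: exp_double[symmetric])
    then have A: "lower * ?A\<^sup>2 = exp (- rate * t) * (upper * state_sq 0)"
      using S0 lower_pos upper_pos by (simp add: power_mult_distrib)
    have BC: "lower * ?B\<^sup>2 = gain_f * N\<^sup>2 / rate" "lower * ?C\<^sup>2 = gain_d * D\<^sup>2 / rate"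
      using lower_pos rate_pos gain_f_pos gain_d_pos by (simp_all add: power_mult_distrib)
    show ?thesis
      unfolding distrib_left A BC by (simp add: add_divide_distrib)
  qed
  finally have "state_sq t \<le> ?A\<^sup>2 + ?B\<^sup>2 + ?C\<^sup>2"
    using lower_pos by simp
  also have "\<dots> \<le> (?A + ?B + ?C)\<^sup>2"
  proof -
    have "(x::real)\<^sup>2 + y\<^sup>2 + z\<^sup>2 \<le> (x + y + z)\<^sup>2" if "0 \<le> x" "0 \<le> y" "0 \<le> z" for x y z
    proof -
      have "0 \<le> x * y" "0 \<le> x * z" "0 \<le> y * z" using that by simp_all
      moreover have "(x + y + z)\<^sup>2 = x\<^sup>2 + y\<^sup>2 + z\<^sup>2 + 2 * (x * y) + 2 * (x * z) + 2 * (y * z)"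
        by (simp add: power2_eq_square algebra_simps)
      ultimately show ?thesis by linarith
    qed
    then show ?thesis using nonneg by blast
  qed
  finally show ?thesis
    using nonneg by (intro real_le_lsqrt) auto
qed

end

lemma exists_lyapunov_weight:
  assumes "0 < a" "0 < c" "0 \<le> \<mu>" "0 < b" "0 < k" "0 < lam"
  shows "\<exists>\<epsilon>. lyapunov_weight a c \<mu> b k lam \<epsilon>"
proof -
  define \<epsilon> where "\<epsilon> = min (c / 2) (min (a * c\<^sup>2 / 2) (min (1 / (4 * a))
    (min (c\<^sup>2 / (2 * (\<mu> + 1))) (k * c\<^sup>2 / (4 * b * lam)))))"
  have le: "\<epsilon> \<le> c / 2" "\<epsilon> \<le> a * c\<^sup>2 / 2" "\<epsilon> \<le> 1 / (4 * a)" "\<epsilon> \<le> c\<^sup>2 / (2 * (\<mu> + 1))"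
    "\<epsilon> \<le> k * c\<^sup>2 / (4 * b * lam)"
    unfolding \<epsilon>_def by (rule min.cobounded1 min.coboundedI2 order_refl)+
  have "0 < \<epsilon>"
    unfolding \<epsilon>_def using assms by simp
  have "\<epsilon> * (2 * (\<mu> + 1)) \<le> c\<^sup>2"
    using le(4) assms by (simp add: pos_le_divide_eq)
  then have "2 * \<epsilon> * \<mu> \<le> c\<^sup>2"
    using \<open>0 < \<epsilon>\<close> by (simp add: algebra_simps)
  moreover have "2 * \<epsilon> \<le> c" "2 * \<epsilon> \<le> a * c\<^sup>2"
    using le(1,2) by linarith+
  moreover have "4 * a * \<epsilon> \<le> 1" "4 * \<epsilon> * b * lam \<le> k * c\<^sup>2"
    using le(3,5) assms by (simp_all add: pos_le_divide_eq algebra_simps)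
  ultimately have "lyapunov_weight a c \<mu> b k lam \<epsilon>"
    using assms \<open>0 < \<epsilon>\<close> by (intro lyapunov_weight.intro)
  then show ?thesis by blast
qed

section \<open>Solutions of the boundary value problem\<close>

lemma interior_open_strip: "interior open_strip = open_strip"
  by (rule interior_open) (simp add: open_Times)

lemma interior_closed_strip: "interior closed_strip = open_strip"
  by (simp add: interior_Times interior_atLeastAtMost_real)

lemma C_class_partials:
  assumes "C_class (Suc n) A w" "(t, x) \<in> interior A"
  shows "((\<lambda>s. w (s, x)) has_real_derivative pd_t A w (t, x)) (at t)"
    and "((\<lambda>y. w (t, y)) has_real_derivative pd_x A w (t, x)) (at x)"
  using assms by (auto simp: pd_t_def pd_x_def extend_to_def DERIV_deriv_iff_real_differentiable)

text \<open>
  The continuations of \<open>u\<^sub>t\<close> and \<open>u\<^sub>x\<close> to the closed strip agree with the derivatives in the open strip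
  and hence inherit their partial derivatives there.
\<close>

lemma solution_is_wave_heat_solution:
  assumes weight: "lyapunov_weight a c \<mu> b k lam \<epsilon>"
    and input: "admissible_input f d" and sol: "is_solution a c \<mu> b k lam f d u \<theta>"
  shows "\<exists>utt uxt uxx \<theta>t \<theta>x. wave_heat_solution a c \<mu> b k lam \<epsilon> f
    (pd_t closed_strip u) (pd_x closed_strip u) utt uxt uxx \<theta> \<theta>t \<theta>x d"
proof -
  let ?ut = "pd_t closed_strip u" and ?ux = "pd_x closed_strip u"
  let ?vt = "pd_t open_strip u" and ?vx = "pd_x open_strip u"
  let ?utt = "pd_t open_strip ?vt" and ?uxt = "pd_t open_strip ?vx" and ?uxx = "pd_x open_strip ?vx"
  obtain \<theta>t \<theta>x \<theta>xx where
    C1: "C1_L2 {0<..} (curry \<theta>) (curry \<theta>t)"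
    and \<theta>x: "\<forall>t>0. curry \<theta>x t \<in> L2 \<and> weak_deriv 1 (curry \<theta> t) (curry \<theta>x t)"
    and \<theta>xx: "\<forall>t>0. curry \<theta>xx t \<in> L2 \<and> weak_deriv 2 (curry \<theta> t) (curry \<theta>xx t)"
    and wave: "\<forall>t>0. \<forall>x\<in>{0<..<1}.
      ?utt (t, x) = c\<^sup>2 * ?uxx (t, x) - \<mu> * ?vt (t, x) - b * \<theta>x (t, x) + f (t, x)"
    and heat: "\<forall>t>0. AE x in lebesgue_on {0<..<1}.
      \<theta>t (t, x) = k * \<theta>xx (t, x) - lam * ?uxt (t, x)"
    and closed: "C_class 1 closed_strip u" and opn: "C_class 2 open_strip u"
    and \<theta>_cont: "C_class 0 closed_strip \<theta>"
    and bc0: "\<forall>t>0. u (t, 0) = 0" "\<forall>t>0. ?ux (t, 1) = - a * ?ut (t, 1) + d t"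
      "\<forall>t>0. \<theta> (t, 0) = 0 \<and> \<theta> (t, 1) = 0"
    using sol unfolding is_solution_def by (elim conjE exE) (rule that)
  have bc: "\<And>t. 0 < t \<Longrightarrow> u (t, 0) = 0" "\<And>t. 0 < t \<Longrightarrow> ?ux (t, 1) = - a * ?ut (t, 1) + d t"
      "\<And>t. 0 < t \<Longrightarrow> \<theta> (t, 0) = 0" "\<And>t. 0 < t \<Longrightarrow> \<theta> (t, 1) = 0"
    using bc0 by blast+
  have cont: "continuous_on closed_strip u" "continuous_on closed_strip ?ut" "continuous_on closed_strip ?ux"
    using closed by (simp_all add: One_nat_def)
  have opn': "C_class (Suc 1) open_strip u" using opn by (simp add: numeral_2_eq_2)
  then have vt: "C_class (Suc 0) open_strip ?vt" and vx: "C_class (Suc 0) open_strip ?vx"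
    by (simp_all add: One_nat_def)
  have cont2: "continuous_on open_strip ?utt" "continuous_on open_strip ?uxt" "continuous_on open_strip ?uxx"
    "continuous_on open_strip ?vx"
    using vt vx by simp_all
  have mem: "(t, x) \<in> interior open_strip" "(t, x) \<in> interior closed_strip"
    if "0 < t" "0 < x" "x < 1" for t x :: real
    using that by (simp_all only: interior_open_strip interior_closed_strip) auto
  note D = C_class_partials[OF closed[unfolded One_nat_def] mem(2)]
  note V = C_class_partials[OF opn' mem(1)] and Vt = C_class_partials[OF vt mem(1)]
    and Vx = C_class_partials[OF vx mem(1)]
  have ut_eq: "?ut (t, x) = ?vt (t, x)" and ux_eq: "?ux (t, x) = ?vx (t, x)"
    if "0 < t" "0 < x" "x < 1" for t x
    using DERIV_unique[OF D(1)[OF that] V(1)[OF that]] DERIV_unique[OF D(2)[OF that] V(2)[OF that]]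
    by simp_all
  have mixed: "pd_x open_strip ?vt (t, x) = ?uxt (t, x)" if "0 < t" "0 < x" "x < 1" for t x
    by (rule mixed_partials_equal[OF V(1) V(2) Vx(1) Vt(2) cont2(4) cont2(2) that])
  have ut_t: "((\<lambda>s. ?ut (s, x)) has_real_derivative ?utt (t, x)) (at t)"
    and ux_t: "((\<lambda>s. ?ux (s, x)) has_real_derivative ?uxt (t, x)) (at t)"
    and ut_x: "((\<lambda>y. ?ut (t, y)) has_real_derivative ?uxt (t, x)) (at x)"
    and ux_x: "((\<lambda>y. ?ux (t, y)) has_real_derivative ?uxx (t, x)) (at x)"
    if tx: "0 < t" "0 < x" "x < 1" for t x
  proof -
    show "((\<lambda>s. ?ut (s, x)) has_real_derivative ?utt (t, x)) (at t)"
      by (rule has_field_derivative_transform_within_open[OF Vt(1)[OF tx], of "{0<..}"])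
        (use tx ut_eq in auto)
    show "((\<lambda>s. ?ux (s, x)) has_real_derivative ?uxt (t, x)) (at t)"
      by (rule has_field_derivative_transform_within_open[OF Vx(1)[OF tx], of "{0<..}"])
        (use tx ux_eq in auto)
    show "((\<lambda>y. ?ut (t, y)) has_real_derivative ?uxt (t, x)) (at x)"
      unfolding mixed[OF tx, symmetric]
      by (rule has_field_derivative_transform_within_open[OF Vt(2)[OF tx], of "{0<..<1}"])
        (use tx ut_eq in auto)
    show "((\<lambda>y. ?ux (t, y)) has_real_derivative ?uxx (t, x)) (at x)"
      by (rule has_field_derivative_transform_within_open[OF Vx(2)[OF tx], of "{0<..<1}"])
        (use tx ux_eq in auto)
  qed
  interpret lyapunov_weight a c \<mu> b k lam \<epsilon> by (rule weight)
  have "wave_heat_solution a c \<mu> b k lam \<epsilon> f ?ut ?ux ?utt ?uxt ?uxx \<theta> \<theta>t \<theta>x d"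
  proof unfold_locales
    fix t :: real
    show "(\<lambda>x. f (t, x)) \<in> L2" if "0 \<le> t"
      using input that by (simp add: admissible_input_def C0_L2_def curry_def)
    show "continuous_on open_strip f"
      using input by (simp add: admissible_input_def)
    show "C1_L2 {0<..} (\<lambda>t x. \<theta> (t, x)) (\<lambda>t x. \<theta>t (t, x))"
      using C1 by (simp add: curry_def)
    assume t: "0 < t"
    show "(\<lambda>x. \<theta>x (t, x)) \<in> L2" "weak_deriv 1 (\<lambda>x. \<theta> (t, x)) (\<lambda>x. \<theta>x (t, x))"
      using \<theta>x t by (simp_all add: curry_def)
    show "weak_deriv 1 (\<lambda>x. k * \<theta>x (t, x) - lam * ?ut (t, x)) (\<lambda>x. \<theta>t (t, x))"
    proof (rule flux_weak_derivative)
      show "weak_deriv 1 (\<lambda>x. \<theta> (t, x)) (\<lambda>x. \<theta>x (t, x))" "(\<lambda>x. \<theta>x (t, x)) \<in> L2"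
        using \<theta>x t by (simp_all add: curry_def)
      show "weak_deriv 2 (\<lambda>x. \<theta> (t, x)) (\<lambda>x. \<theta>xx (t, x))" "(\<lambda>x. \<theta>xx (t, x)) \<in> L2"
        using \<theta>xx t by (simp_all add: curry_def)
      show "continuous_on {0..1} (\<lambda>x. ?ut (t, x))"
        by (rule continuous_on_time_slice[OF cont(2)]) (use t in simp)
      show "continuous_on {0<..<1} (\<lambda>x. ?uxt (t, x))"
        by (rule continuous_on_time_slice[OF cont2(2)]) (use t in simp)
      show "((\<lambda>x. ?ut (t, x)) has_real_derivative ?uxt (t, x)) (at x)" if "0 < x" "x < 1" for x
        by (rule ut_x[OF t that])
      show "(\<lambda>x. \<theta>t (t, x)) \<in> L2"
        using C1 t by (simp add: C1_L2_def C0_L2_def curry_def)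
      show "AE x in lebesgue_on {0<..<1}. \<theta>t (t, x) = k * \<theta>xx (t, x) - lam * ?uxt (t, x)"
        using heat t by blast
    qed
    show "?ut (t, 0) = 0"
      by (rule time_derivative_zero_on_boundary[OF cont(1) bc(1) D(1) cont(2) t])
  next
    fix t x :: real assume "0 < t" "0 < x" "x < 1"
    then show "?utt (t, x) = c\<^sup>2 * ?uxx (t, x) - \<mu> * ?ut (t, x) - b * \<theta>x (t, x) + f (t, x)"
      using wave by (simp add: ut_eq)
  qed (fact cont cont2 \<theta>_cont[unfolded C_class.simps] bc ut_t ut_x ux_t ux_x)+
  then show ?thesis by blast
qed

theorem theorem2:
  fixes a c \<mu> b k lam :: real
  assumes "a > 0" and "c > 0" and "\<mu> \<ge> 0" and "b > 0" and "k > 0" and "lam > 0"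
  shows "\<exists>\<omega> G \<gamma>1 \<gamma>2 :: real. \<omega> > 0 \<and> G > 0 \<and> \<gamma>1 > 0 \<and> \<gamma>2 > 0 \<and>
    (\<forall>f d u \<theta>. admissible_input f d \<longrightarrow> is_solution a c \<mu> b k lam f d u \<theta> \<longrightarrow>
      (\<forall>t\<ge>0. state_norm u \<theta> t \<le>
         G * exp (- \<omega> * t) * state_norm u \<theta> 0
         + \<gamma>1 * (SUP s\<in>{0..t}. norm2 (curry f s))
         + \<gamma>2 * (SUP s\<in>{0..t}. \<bar>d s\<bar>)))"
proof -
  obtain \<epsilon> where weight: "lyapunov_weight a c \<mu> b k lam \<epsilon>"
    using exists_lyapunov_weight assms by blast
  interpret lyapunov_weight a c \<mu> b k lam \<epsilon> by (rule weight)
  show ?thesis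
  proof (intro exI conjI allI impI)
    show "0 < rate / 2" "0 < sqrt (upper / lower)" "0 < sqrt (gain_f / (rate * lower))"
      "0 < sqrt (gain_d / (rate * lower))"
      using rate_pos lower_pos upper_pos gain_f_pos gain_d_pos by simp_all
    fix f :: "real \<times> real \<Rightarrow> real" and d :: "real \<Rightarrow> real" and u \<theta> :: "real \<times> real \<Rightarrow> real" and t :: real
    assume input: "admissible_input f d" and sol: "is_solution a c \<mu> b k lam f d u \<theta>" and t: "0 \<le> t"
    obtain utt uxt uxx \<theta>t \<theta>x where "wave_heat_solution a c \<mu> b k lam \<epsilon> f
        (pd_t closed_strip u) (pd_x closed_strip u) utt uxt uxx \<theta> \<theta>t \<theta>x d"
      using solution_is_wave_heat_solution[OF weight input sol] by blast
    then interpret S: wave_heat_solution a c \<mu> b k lam \<epsilon> f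
      "pd_t closed_strip u" "pd_x closed_strip u" utt uxt uxx \<theta> \<theta>t \<theta>x d .
    have state: "state_norm u \<theta> r = sqrt (S.state_sq r)" for r
      by (simp add: state_norm_def S.state_sq_def curry_def)
    have sup_bound: "g s \<le> (SUP s\<in>{0..t}. g s)" if "continuous_on {0..} g" "s \<in> {0..t}"
      for g :: "real \<Rightarrow> real" and s
    proof (rule cSUP_upper[OF that(2)])
      have "compact (g ` {0..t})"
        by (intro compact_continuous_image continuous_on_subset[OF that(1)]) auto
      then show "bdd_above (g ` {0..t})"
        by (intro bounded_imp_bdd_above compact_imp_bounded)
    qed
    have contN: "continuous_on {0..} (\<lambda>s. norm2 (curry f s))"
      using input by (intro C0_L2_norm2_continuous) (simp add: admissible_input_def)
    have contD: "continuous_on {0..} (\<lambda>s. \<bar>d s\<bar>)"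
      using input by (intro continuous_on_rabs) (simp add: admissible_input_def)
    let ?N = "SUP s\<in>{0..t}. norm2 (curry f s)" and ?D = "SUP s\<in>{0..t}. \<bar>d s\<bar>"
    have N: "norm2 (curry f s) \<le> ?N" and D: "\<bar>d s\<bar> \<le> ?D" if "0 \<le> s" "s \<le> t" for s
      using sup_bound[OF contN, of s] sup_bound[OF contD, of s] that by simp_all
    have "0 \<le> ?N" "0 \<le> ?D"
      using N[of 0] D[of 0] t norm2_nonneg[of "curry f 0"] by linarith+
    then show "state_norm u \<theta> t \<le> sqrt (upper / lower) * exp (- (rate / 2) * t) * state_norm u \<theta> 0
        + sqrt (gain_f / (rate * lower)) * ?N + sqrt (gain_d / (rate * lower)) * ?D"
      unfolding state using N D by (intro S.state_estimate t) (simp_all add: curry_def)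
  qed
qed

end
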